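(* There exists a conformal product structure on $S^3$ whose associated codimension-one foliation is the Reeb foliation. That is, there exist a smooth function $f:[0,1)\to\mathbb{R}$ satisfying conditions (i)–(iv) of the context, a smooth Riemannian metric $\tilde g$ on $S^3$, a Weyl connection $D$ on $(S^3,[\tilde g])$, and a $\tilde g$-orthogonal decomposition $TS^3=T_1\oplus T_2$ into $D$-parallel smooth distributions of rank $2$ and $1$ respectively, such that $T_1$ is the tangent distribution of the Reeb foliation $\tilde{\mathcal F}_f$ of $S^3$.
   Context: Weyl connections. A Weyl connection on a conformal manifold $(M,c)$ is a torsion-free linear connection $D$ on $TM$ compatible with $c$; for $g\in c$ with Levi-Civita connection $\nabla$ there is a 1-form $\theta$ (the Lee form) with $D_XY=\nabla_XY+\theta(X)Y+\theta(Y)X-g(X,Y)\theta^\sharp$. A conformal product structure on $(M,g)$ is a Weyl connection $D$ on $(M,[g])$ together with a decomposition $TM=T_1\oplus T_2$ into orthogonal, $D$-parallel, non-trivial distributions. Conditions on $f$: (i) $f'(r)>0$ for $0<r<1$; (ii) $\lim_{r\to1}f(r)=+\infty$; (iii) $f^{(2k+1)}(0)=0$ for all $k\in\mathbb{N}$; (iv) $\lim_{r\to1^-}\frac{d^k}{dr^k}\left(\frac1{f'(r)}\right)=0$ for all $k\in\mathbb{N}$, where $\mathbb N$ includes $0$. Reeb foliation. Write $S^3=\{(z_1,z_2)\in\mathbb{C}^2:|z_1|^2+|z_2|^2=1\}$, $\mathring V_1=\{|z_1|^2>\frac12\}$, $\mathring V_2=\{|z_2|^2>\frac12\}$ and $T^2=\{|z_1|^2=|z_2|^2=\frac12\}$.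 Let $\mathring D^2$ be the open unit disc in $\mathbb{C}$. There are diffeomorphisms $\Phi_i:\mathring D^2\times S^1\to\mathring V_i$ given by $\Phi_1(w_1,w_2)=\left(w_2\sqrt{1-|w_1|^2/2},\,w_1/\sqrt2\right)$ and $\Phi_2(w_1,w_2)=\left(w_1/\sqrt2,\,w_2\sqrt{1-|w_1|^2/2}\right)$. The foliation $\mathcal F_f$ of $\mathring D^2\times S^1$ is the one whose leaves are the images of the surfaces $\{(w,t)\in\mathring D^2\times\mathbb{R}:t-f(|w|)=c\}$, $c\in\mathbb{R}$, under $(w,t)\mapsto(w,e^{it})$. The Reeb foliation $\tilde{\mathcal F}_f$ of $S^3$ is the foliation whose leaves are the images under $\Phi_1$ and $\Phi_2$ of the leaves of $\mathcal F_f$, together with the compact leaf $T^2$. *)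

theory Defs
  imports "HOL-Analysis.Analysis"
begin

section \<open>Smooth maps\<close>

primrec Ck_open :: "nat \<Rightarrow> 'a::euclidean_space set \<Rightarrow> ('a \<Rightarrow> 'b::real_normed_vector) \<Rightarrow> bool" where
  "Ck_open 0 U f \<longleftrightarrow> continuous_on U f"
| "Ck_open (Suc k) U f \<longleftrightarrow>
     (\<forall>x\<in>U. f differentiable (at x)) \<and>
     (\<forall>v. Ck_open k U (\<lambda>x. frechet_derivative f (at x) v))"

(* Smoothness on an arbitrary subset A means the existence of local smooth extensions. For an
   embedded submanifold this is intrinsic smoothness; for {0..<1} it is smoothness up to 0. *)
definition smooth_map_on :: "'a::euclidean_space set \<Rightarrow> ('a \<Rightarrow> 'b::real_normed_vector) \<Rightarrow> bool" where
  "smooth_map_on A f \<longleftrightarrow>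
     (\<forall>p\<in>A. \<exists>U F. open U \<and> p \<in> U \<and> (\<forall>k. Ck_open k U F) \<and> (\<forall>q\<in>U \<inter> A. F q = f q))"


section \<open>Embedded submanifolds of a Euclidean space\<close>

(* Throughout, M stands for an embedded submanifold of the Euclidean space 'a, and tangent vectors
   of M are vectors of 'a. *)

definition tangent_space :: "'a::euclidean_space set \<Rightarrow> 'a \<Rightarrow> 'a set" where
  "tangent_space M p =
     {v. \<exists>\<gamma> e. e > 0 \<and> smooth_map_on {-e<..<e} \<gamma> \<and> \<gamma> ` {-e<..<e} \<subseteq> M \<and> \<gamma> 0 = p \<and>
            (\<gamma> has_vector_derivative v) (at (0::real))}"

(* Fields are normalised to vanish off M, so that distinct functions are distinct fields. *)
definition vector_fields :: "'a::euclidean_space set \<Rightarrow> ('a \<Rightarrow> 'a) set" where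
  "vector_fields M =
     {X. smooth_map_on M X \<and> (\<forall>p\<in>M. X p \<in> tangent_space M p) \<and> (\<forall>p. p \<notin> M \<longrightarrow> X p = 0)}"

(* The derivative of f at p within M is unique only on tangent vectors of M, and this operator is
   applied only to those. *)
definition dir_deriv ::
    "'a::euclidean_space set \<Rightarrow> ('a \<Rightarrow> 'b::real_normed_vector) \<Rightarrow> 'a \<Rightarrow> 'a \<Rightarrow> 'b" where
  "dir_deriv M f p v = frechet_derivative f (at p within M) v"

(* The ambient formula [X,Y] = dY(X) - dX(Y); the bracket of fields tangent to M is tangent to M. *)
definition lie_bracket :: "'a::euclidean_space set \<Rightarrow> ('a \<Rightarrow> 'a) \<Rightarrow> ('a \<Rightarrow> 'a) \<Rightarrow> 'a \<Rightarrow> 'a" where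
  "lie_bracket M X Y p =
     (if p \<in> M then dir_deriv M Y p (X p) - dir_deriv M X p (Y p) else 0)"

definition one_form :: "'a::euclidean_space set \<Rightarrow> ('a \<Rightarrow> 'a \<Rightarrow> real) \<Rightarrow> bool" where
  "one_form M \<theta> \<longleftrightarrow>
     (\<forall>p\<in>M. \<forall>u\<in>tangent_space M p. \<forall>v\<in>tangent_space M p. \<forall>a.
        \<theta> p (u + v) = \<theta> p u + \<theta> p v \<and> \<theta> p (a *\<^sub>R u) = a * \<theta> p u) \<and>
     (\<forall>X\<in>vector_fields M. smooth_map_on M (\<lambda>p. \<theta> p (X p)))"

definition riemannian_metric :: "'a::euclidean_space set \<Rightarrow> ('a \<Rightarrow> 'a \<Rightarrow> 'a \<Rightarrow> real) \<Rightarrow> bool" where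
  "riemannian_metric M g \<longleftrightarrow>
     (\<forall>p\<in>M. \<forall>u\<in>tangent_space M p. \<forall>v\<in>tangent_space M p. \<forall>w\<in>tangent_space M p. \<forall>a.
        g p (u + v) w = g p u w + g p v w \<and>
        g p (a *\<^sub>R u) w = a * g p u w \<and>
        g p u v = g p v u) \<and>
     (\<forall>p\<in>M. \<forall>u\<in>tangent_space M p. u \<noteq> 0 \<longrightarrow> g p u u > 0) \<and>
     (\<forall>X\<in>vector_fields M. \<forall>Y\<in>vector_fields M. smooth_map_on M (\<lambda>p. g p (X p) (Y p)))"

definition conformal_class ::
    "'a::euclidean_space set \<Rightarrow> ('a \<Rightarrow> 'a \<Rightarrow> 'a \<Rightarrow> real) \<Rightarrow> ('a \<Rightarrow> 'a \<Rightarrow> 'a \<Rightarrow> real) set" where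
  "conformal_class M g =
     {h. riemannian_metric M h \<and>
         (\<exists>\<phi>. smooth_map_on M \<phi> \<and> (\<forall>p\<in>M. \<phi> p > 0) \<and>
              (\<forall>p\<in>M. \<forall>u\<in>tangent_space M p. \<forall>v\<in>tangent_space M p. h p u v = \<phi> p * g p u v))}"


section \<open>Weyl connections\<close>

(* D X Y is the covariant derivative of the field Y in direction of the field X. *)
definition linear_connection ::
    "'a::euclidean_space set \<Rightarrow> (('a \<Rightarrow> 'a) \<Rightarrow> ('a \<Rightarrow> 'a) \<Rightarrow> 'a \<Rightarrow> 'a) \<Rightarrow> bool" where
  "linear_connection M D \<longleftrightarrow>
     (\<forall>X\<in>vector_fields M. \<forall>Y\<in>vector_fields M. D X Y \<in> vector_fields M) \<and>
     (\<forall>X\<in>vector_fields M. \<forall>X'\<in>vector_fields M. \<forall>Y\<in>vector_fields M.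
        D (\<lambda>p. X p + X' p) Y = (\<lambda>p. D X Y p + D X' Y p)) \<and>
     (\<forall>X\<in>vector_fields M. \<forall>Y\<in>vector_fields M. \<forall>Y'\<in>vector_fields M.
        D X (\<lambda>p. Y p + Y' p) = (\<lambda>p. D X Y p + D X Y' p)) \<and>
     (\<forall>\<phi> :: 'a \<Rightarrow> real. \<forall>X\<in>vector_fields M. \<forall>Y\<in>vector_fields M. smooth_map_on M \<phi> \<longrightarrow>
        D (\<lambda>p. \<phi> p *\<^sub>R X p) Y = (\<lambda>p. \<phi> p *\<^sub>R D X Y p)) \<and>
     (\<forall>\<phi> :: 'a \<Rightarrow> real. \<forall>X\<in>vector_fields M. \<forall>Y\<in>vector_fields M. smooth_map_on M \<phi> \<longrightarrow>
        D X (\<lambda>p. \<phi> p *\<^sub>R Y p) =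
          (\<lambda>p. dir_deriv M \<phi> p (X p) *\<^sub>R Y p + \<phi> p *\<^sub>R D X Y p))"

definition torsion_free ::
    "'a::euclidean_space set \<Rightarrow> (('a \<Rightarrow> 'a) \<Rightarrow> ('a \<Rightarrow> 'a) \<Rightarrow> 'a \<Rightarrow> 'a) \<Rightarrow> bool" where
  "torsion_free M D \<longleftrightarrow>
     (\<forall>X\<in>vector_fields M. \<forall>Y\<in>vector_fields M. \<forall>p\<in>M.
        D X Y p - D Y X p = lie_bracket M X Y p)"

(* (D_X g)(Y,Z) *)
definition cov_deriv_metric ::
    "'a::euclidean_space set \<Rightarrow> (('a \<Rightarrow> 'a) \<Rightarrow> ('a \<Rightarrow> 'a) \<Rightarrow> 'a \<Rightarrow> 'a) \<Rightarrow> ('a \<Rightarrow> 'a \<Rightarrow> 'a \<Rightarrow> real) \<Rightarrow>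
     ('a \<Rightarrow> 'a) \<Rightarrow> ('a \<Rightarrow> 'a) \<Rightarrow> ('a \<Rightarrow> 'a) \<Rightarrow> 'a \<Rightarrow> real" where
  "cov_deriv_metric M D g X Y Z p =
     dir_deriv M (\<lambda>q. g q (Y q) (Z q)) p (X p) - g p (D X Y p) (Z p) - g p (Y p) (D X Z p)"

(* D preserves the conformal class: D g = -2 \<theta> \<otimes> g for every g in the class, where the Lee form
   \<theta> depends on g. The sign is the one for which a torsion-free D is given by
   D_X Y = \<nabla>_X Y + \<theta>(X) Y + \<theta>(Y) X - g(X,Y) \<theta>^#. *)
definition conformally_compatible ::
    "'a::euclidean_space set \<Rightarrow> ('a \<Rightarrow> 'a \<Rightarrow> 'a \<Rightarrow> real) set \<Rightarrow>
     (('a \<Rightarrow> 'a) \<Rightarrow> ('a \<Rightarrow> 'a) \<Rightarrow> 'a \<Rightarrow> 'a) \<Rightarrow> bool" where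
  "conformally_compatible M c D \<longleftrightarrow>
     (\<forall>g\<in>c. \<exists>\<theta>. one_form M \<theta> \<and>
        (\<forall>X\<in>vector_fields M. \<forall>Y\<in>vector_fields M. \<forall>Z\<in>vector_fields M. \<forall>p\<in>M.
           cov_deriv_metric M D g X Y Z p = - 2 * \<theta> p (X p) * g p (Y p) (Z p)))"

definition weyl_connection ::
    "'a::euclidean_space set \<Rightarrow> ('a \<Rightarrow> 'a \<Rightarrow> 'a \<Rightarrow> real) set \<Rightarrow>
     (('a \<Rightarrow> 'a) \<Rightarrow> ('a \<Rightarrow> 'a) \<Rightarrow> 'a \<Rightarrow> 'a) \<Rightarrow> bool" where
  "weyl_connection M c D \<longleftrightarrow>
     linear_connection M D \<and> torsion_free M D \<and> conformally_compatible M c D"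


section \<open>Distributions and conformal product structures\<close>

definition smooth_distribution ::
    "'a::euclidean_space set \<Rightarrow> nat \<Rightarrow> ('a \<Rightarrow> 'a set) \<Rightarrow> bool" where
  "smooth_distribution M k E \<longleftrightarrow>
     (\<forall>p\<in>M. E p \<subseteq> tangent_space M p \<and> subspace (E p) \<and> dim (E p) = k) \<and>
     (\<forall>p\<in>M. \<exists>U (X :: nat \<Rightarrow> 'a \<Rightarrow> 'a). open U \<and> p \<in> U \<and>
        (\<forall>i<k. smooth_map_on (U \<inter> M) (X i)) \<and>
        (\<forall>q\<in>U \<inter> M. E q = span ((\<lambda>i. X i q) ` {..<k})))"

definition parallel_distribution ::
    "'a::euclidean_space set \<Rightarrow> (('a \<Rightarrow> 'a) \<Rightarrow> ('a \<Rightarrow> 'a) \<Rightarrow> 'a \<Rightarrow> 'a) \<Rightarrow> ('a \<Rightarrow> 'a set) \<Rightarrow> bool" where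
  "parallel_distribution M D E \<longleftrightarrow>
     (\<forall>X\<in>vector_fields M. \<forall>Y\<in>vector_fields M.
        (\<forall>p\<in>M. Y p \<in> E p) \<longrightarrow> (\<forall>p\<in>M. D X Y p \<in> E p))"

definition orthogonal_decomposition ::
    "'a::euclidean_space set \<Rightarrow> ('a \<Rightarrow> 'a \<Rightarrow> 'a \<Rightarrow> real) \<Rightarrow> ('a \<Rightarrow> 'a set) \<Rightarrow> ('a \<Rightarrow> 'a set) \<Rightarrow> bool" where
  "orthogonal_decomposition M g T\<^sub>1 T\<^sub>2 \<longleftrightarrow>
     (\<forall>p\<in>M. {u + v | u v. u \<in> T\<^sub>1 p \<and> v \<in> T\<^sub>2 p} = tangent_space M p \<and>
            T\<^sub>1 p \<inter> T\<^sub>2 p = {0} \<and>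
            (\<forall>u\<in>T\<^sub>1 p. \<forall>v\<in>T\<^sub>2 p. g p u v = 0))"

definition conformal_product_structure ::
    "'a::euclidean_space set \<Rightarrow> ('a \<Rightarrow> 'a \<Rightarrow> 'a \<Rightarrow> real) \<Rightarrow>
     (('a \<Rightarrow> 'a) \<Rightarrow> ('a \<Rightarrow> 'a) \<Rightarrow> 'a \<Rightarrow> 'a) \<Rightarrow> ('a \<Rightarrow> 'a set) \<Rightarrow> ('a \<Rightarrow> 'a set) \<Rightarrow> bool" where
  "conformal_product_structure M g D T\<^sub>1 T\<^sub>2 \<longleftrightarrow>
     weyl_connection M (conformal_class M g) D \<and>
     (\<exists>k\<ge>1. smooth_distribution M k T\<^sub>1) \<and>
     (\<exists>l\<ge>1. smooth_distribution M l T\<^sub>2) \<and>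
     orthogonal_decomposition M g T\<^sub>1 T\<^sub>2 \<and>
     parallel_distribution M D T\<^sub>1 \<and> parallel_distribution M D T\<^sub>2"

(* A foliation is given by its set of leaves. Tangent spaces of leaves are taken with the
   embedded-submanifold notion above; all leaves of the Reeb foliation are embedded. *)
definition tangent_distribution_of ::
    "'a::euclidean_space set set \<Rightarrow> ('a \<Rightarrow> 'a set) \<Rightarrow> bool" where
  "tangent_distribution_of \<L> E \<longleftrightarrow> (\<forall>L\<in>\<L>. \<forall>p\<in>L. E p = tangent_space L p)"


section \<open>The Reeb foliation of the three-sphere\<close>

definition S3 :: "(complex \<times> complex) set" where
  "S3 = {(z\<^sub>1, z\<^sub>2). (cmod z\<^sub>1)\<^sup>2 + (cmod z\<^sub>2)\<^sup>2 = 1}"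

definition torus :: "(complex \<times> complex) set" where
  "torus = {(z\<^sub>1, z\<^sub>2). (cmod z\<^sub>1)\<^sup>2 = 1 / 2 \<and> (cmod z\<^sub>2)\<^sup>2 = 1 / 2}"

definition \<Phi>\<^sub>1 :: "complex \<times> complex \<Rightarrow> complex \<times> complex" where
  "\<Phi>\<^sub>1 = (\<lambda>(w\<^sub>1, w\<^sub>2).
     (w\<^sub>2 * complex_of_real (sqrt (1 - (cmod w\<^sub>1)\<^sup>2 / 2)), w\<^sub>1 / complex_of_real (sqrt 2)))"

definition \<Phi>\<^sub>2 :: "complex \<times> complex \<Rightarrow> complex \<times> complex" where
  "\<Phi>\<^sub>2 = (\<lambda>(w\<^sub>1, w\<^sub>2).
     (w\<^sub>1 / complex_of_real (sqrt 2), w\<^sub>2 * complex_of_real (sqrt (1 - (cmod w\<^sub>1)\<^sup>2 / 2))))"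

(* The iterated derivatives at the endpoint 0 are one-sided; f is relevant only on {0..<1}. *)
definition reeb_function :: "(real \<Rightarrow> real) \<Rightarrow> bool" where
  "reeb_function f \<longleftrightarrow>
     smooth_map_on {0..<1} f \<and>
     (\<forall>r. 0 < r \<and> r < 1 \<longrightarrow> deriv f r > 0) \<and>
     filterlim f at_top (at_left 1) \<and>
     (\<forall>k::nat. ((\<lambda>h r. vector_derivative h (at r within {0..<1})) ^^ (2 * k + 1)) f 0 = 0) \<and>
     (\<forall>k::nat. ((deriv ^^ k) (\<lambda>r. 1 / deriv f r) \<longlongrightarrow> 0) (at_left 1))"

definition open_torus_leaf :: "(real \<Rightarrow> real) \<Rightarrow> real \<Rightarrow> (complex \<times> complex) set" where
  "open_torus_leaf f c =
     (\<lambda>(w, t). (w, cis t)) ` {(w :: complex, t :: real). cmod w < 1 \<and> t - f (cmod w) = c}"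

definition open_torus_foliation :: "(real \<Rightarrow> real) \<Rightarrow> (complex \<times> complex) set set" where
  "open_torus_foliation f = range (open_torus_leaf f)"

definition reeb_foliation :: "(real \<Rightarrow> real) \<Rightarrow> (complex \<times> complex) set set" where
  "reeb_foliation f =
     (\<lambda>L. \<Phi>\<^sub>1 ` L) ` open_torus_foliation f \<union>
     (\<lambda>L. \<Phi>\<^sub>2 ` L) ` open_torus_foliation f \<union> {torus}"

end

theory Submission
  imports Defs
begin

text \<open>A conformal product structure with factors of rank two and one amounts to a pair of forms. Suppose
that a real one-form \<open>\<alpha>\<close> and a complex one-form \<open>\<omega>\<close> on a three-manifold \<open>M\<close> together identify every
tangent space with \<open>\<real> \<times> \<complex>\<close>. Let \<open>T\<^sub>1\<close> be the kernel of \<open>\<alpha>\<close>, let \<open>T\<^sub>2\<close> be the kernel of \<open>\<omega>\<close>, and let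
\<open>g = |\<omega>|\<^sup>2 + \<alpha>\<^sup>2\<close>, which makes the two orthogonal. A connection of the form
\<open>\<alpha>(D\<^sub>X Y) = X(\<alpha>(Y)) + Re B(X) \<alpha>(Y)\<close>, \<open>\<omega>(D\<^sub>X Y) = X(\<omega>(Y)) + B(X) \<omega>(Y)\<close>, with a complex-valued
one-form \<open>B\<close>, preserves both distributions and the conformal class, with Lee form \<open>Re B\<close>. It is
torsion-free exactly when \<open>d\<alpha> = - Re B \<and> \<alpha>\<close> and \<open>d\<omega> = - B \<and> \<omega>\<close>. Evaluated on the dual frame, these
structure equations are linear equations for \<open>B\<close>, which are solvable as soon as
\<open>\<alpha> \<and> d\<alpha> = 0\<close> and \<open>\<omega> \<and> d\<omega> = 0\<close>. This is the content of the locale \<open>integrable_coframe\<close>; the key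
steps are \<open>structure_equation_\<alpha>\<close> and \<open>structure_equation_\<omega>\<close>.

On the three-sphere, the form \<open>\<omega> = z\<^sub>1 d(cnj z\<^sub>2) - \<i> cnj z\<^sub>2 dz\<^sub>1\<close> is holomorphic in the coordinates
\<open>(z\<^sub>1, cnj z\<^sub>2)\<close> and satisfies \<open>\<omega> \<and> d\<omega> = 0\<close>. Its kernel in the tangent bundle of the sphere is spanned
by a vector field that is tangent to the core circles of both solid tori and crosses the Clifford
torus transversally. The conjugation of \<open>z\<^sub>2\<close> selects the orientation for which this field is
transverse to every leaf of the Reeb foliation. The Reeb foliation is the kernel of
\<open>\<alpha> = \<chi>(|z\<^sub>2|\<^sup>2) Im(cnj z\<^sub>1 dz\<^sub>1) - \<chi>(|z\<^sub>1|\<^sup>2) Im(cnj z\<^sub>2 dz\<^sub>2) - 2 d|z\<^sub>2|\<^sup>2\<close>, where \<open>\<chi>\<close> is smooth, positive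
to the left of \<open>1/2\<close>, and zero from there on. On each solid torus this is \<open>dt - f'(r) dr\<close> up to a
factor, with \<open>f(r) = exp (1 / (1 - r\<^sup>2))\<close>. The reciprocal of \<open>f'\<close> is flat at \<open>r = 1\<close>, and this is what
lets the two halves fit together smoothly along the torus. The lemmas about the sphere that carry the
argument are \<open>reeb_form_integrable\<close>, \<open>ext_deriv_trans_flow_dir\<close>, \<open>reeb_flow_dir_pos\<close>
(transversality) and \<open>tangent_distribution_reeb\<close>.\<close>

section \<open>Calculus of smooth maps on open sets\<close>

lemma frechet_derivative_cong_open:
  assumes "open U" "x \<in> U" "\<And>y. y \<in> U \<Longrightarrow> f y = g y"
  shows "frechet_derivative f (at x) = frechet_derivative g (at x)"
proof -
  have "(f has_derivative D) (at x) = (g has_derivative D) (at x)" for D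
    using assms has_derivative_transform_within_open[of f D x UNIV U g]
      has_derivative_transform_within_open[of g D x UNIV U f] by auto
  then show ?thesis by (simp add: frechet_derivative_def)
qed

lemma Ck_open_cong:
  assumes "open U" "\<And>y. y \<in> U \<Longrightarrow> f y = g y" "Ck_open k U f"
  shows "Ck_open k U g"
  using assms(2,3)
proof (induction k arbitrary: f g)
  case 0
  then show ?case by (simp cong: continuous_on_cong)
next
  case (Suc k)
  have "g differentiable (at x)" if "x \<in> U" for x
    using has_derivative_transform_within_open[of f "frechet_derivative f (at x)" x UNIV U g]
      Suc.prems that assms(1) Ck_open.simps(2) differentiableI frechet_derivative_works by metis
  moreover have "Ck_open k U (\<lambda>x. frechet_derivative g (at x) v)" for v
    using Suc.IH[of "\<lambda>x. frechet_derivative f (at x) v"] Suc.prems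
      frechet_derivative_cong_open[OF assms(1) _ Suc.prems(1)] by simp
  ultimately show ?case by simp
qed

lemma Ck_open_subset: "Ck_open k U f \<Longrightarrow> V \<subseteq> U \<Longrightarrow> Ck_open k V f"
  by (induction k arbitrary: f) (auto intro: continuous_on_subset)

lemma Ck_open_local:
  assumes "\<And>x. x \<in> A \<Longrightarrow> \<exists>U. open U \<and> x \<in> U \<and> Ck_open k U f"
  shows "Ck_open k A f"
  using assms
proof (induction k arbitrary: f)
  case 0
  have "continuous (at x) f" if x: "x \<in> A" for x
  proof -
    obtain U where "open U" "x \<in> U" "continuous_on U f" using 0[OF x] by auto
    then show ?thesis by (simp add: continuous_on_eq_continuous_at)
  qed
  then show ?case by (simp add: continuous_at_imp_continuous_on)
next
  case (Suc k)
  have "f differentiable (at x)" if "x \<in> A" for x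
    using Suc.prems[OF that] by (metis Ck_open.simps(2))
  moreover have "Ck_open k A (\<lambda>x. frechet_derivative f (at x) v)" for v
  proof (rule Suc.IH)
    fix x assume x: "x \<in> A"
    obtain U where "open U" "x \<in> U" "Ck_open (Suc k) U f" using Suc.prems[OF x] by blast
    then show "\<exists>U. open U \<and> x \<in> U \<and> Ck_open k U (\<lambda>x. frechet_derivative f (at x) v)"
      by (intro exI[of _ U]) simp
  qed
  ultimately show ?case by simp
qed

lemma Ck_open_SucD: "Ck_open (Suc k) U f \<Longrightarrow> Ck_open k U f"
proof (induction k arbitrary: f)
  case 0
  then show ?case
    by (simp add: continuous_at_imp_continuous_on differentiable_imp_continuous_within)
next
  case (Suc k)
  have "Ck_open (Suc k) U (\<lambda>x. frechet_derivative f (at x) v)" for v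
    using Suc.prems unfolding Ck_open.simps(2)[of "Suc k"] by blast
  then have "Ck_open k U (\<lambda>x. frechet_derivative f (at x) v)" for v
    by (rule Suc.IH)
  moreover have "\<forall>x\<in>U. f differentiable (at x)"
    using Suc.prems unfolding Ck_open.simps(2)[of "Suc k"] by blast
  ultimately show ?case unfolding Ck_open.simps(2) by blast
qed

text \<open>The recursive clause of \<open>Ck_open\<close> with an arbitrary candidate for the derivative in place of
\<open>frechet_derivative\<close>.\<close>

lemma Ck_open_SucI:
  assumes "open U" "\<And>x. x \<in> U \<Longrightarrow> (f has_derivative f' x) (at x)"
    "\<And>v. Ck_open k U (\<lambda>x. f' x v)"
  shows "Ck_open (Suc k) U f"
proof -
  have "Ck_open k U (\<lambda>x. frechet_derivative f (at x) v)" for v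
    by (rule Ck_open_cong[OF assms(1) _ assms(3)[of v]])
      (metis assms(2) frechet_derivative_at)
  moreover have "f differentiable (at x)" if "x \<in> U" for x
    using assms(2)[OF that] by (rule differentiableI)
  ultimately show ?thesis by simp
qed

lemma Ck_open_Suc_has_derivative:
  "Ck_open (Suc k) U f \<Longrightarrow> x \<in> U \<Longrightarrow> (f has_derivative frechet_derivative f (at x)) (at x)"
  by (simp add: frechet_derivative_works)

lemma Ck_open_const: "Ck_open k U (\<lambda>x. c)"
  by (induction k arbitrary: c) auto

lemma Ck_open_bounded_linear:
  assumes "open U" "bounded_linear h" "Ck_open k U f"
  shows "Ck_open k U (\<lambda>x. h (f x))"
  using assms(3)
proof (induction k arbitrary: f)
  case 0
  then show ?case using bounded_linear.continuous_on[OF assms(2)] by simp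
next
  case (Suc k)
  show ?case
  proof (rule Ck_open_SucI[OF assms(1), where f' = "\<lambda>x v. h (frechet_derivative f (at x) v)"])
    show "((\<lambda>x. h (f x)) has_derivative (\<lambda>v. h (frechet_derivative f (at x) v))) (at x)"
      if "x \<in> U" for x
      by (rule bounded_linear.has_derivative[OF assms(2) Ck_open_Suc_has_derivative[OF Suc.prems that]])
    show "Ck_open k U (\<lambda>x. h (frechet_derivative f (at x) v))" for v
      using Suc by simp
  qed
qed

lemma Ck_open_id: "open U \<Longrightarrow> Ck_open k U (\<lambda>x. x)"
proof (induction k)
  case (Suc k)
  show ?case
    by (rule Ck_open_SucI[OF Suc.prems, where f' = "\<lambda>x v. v"])
      (auto simp: Ck_open_const intro: has_derivative_ident)
qed auto

lemma Ck_open_add: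
  assumes "open U" "Ck_open k U f" "Ck_open k U g"
  shows "Ck_open k U (\<lambda>x. f x + g x)"
  using assms(2,3)
proof (induction k arbitrary: f g)
  case 0
  then show ?case by (simp add: continuous_on_add)
next
  case (Suc k)
  show ?case
    by (rule Ck_open_SucI[OF assms(1) has_derivative_add[OF
        Ck_open_Suc_has_derivative[OF Suc.prems(1)] Ck_open_Suc_has_derivative[OF Suc.prems(2)]]])
      (use Suc in auto)
qed

lemma Ck_open_sum:
  assumes "open U" "finite I" "\<And>i. i \<in> I \<Longrightarrow> Ck_open k U (f i)"
  shows "Ck_open k U (\<lambda>x. \<Sum>i\<in>I. f i x)"
  using assms(2,3)
  by (induction I rule: finite_induct) (auto simp: Ck_open_const intro: Ck_open_add[OF assms(1)])

lemma Ck_open_bounded_bilinear: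
  assumes "open U" "bounded_bilinear h" "Ck_open k U f" "Ck_open k U g"
  shows "Ck_open k U (\<lambda>x. h (f x) (g x))"
  using assms(3,4)
proof (induction k arbitrary: f g)
  case 0
  then show ?case using bounded_bilinear.continuous_on[OF assms(2)] by auto
next
  case (Suc k)
  show ?case
  proof (rule Ck_open_SucI[OF assms(1) bounded_bilinear.FDERIV[OF assms(2)
        Ck_open_Suc_has_derivative[OF Suc.prems(1)] Ck_open_Suc_has_derivative[OF Suc.prems(2)]]])
    fix v
    show "Ck_open k U (\<lambda>x. h (f x) (frechet_derivative g (at x) v)
                          + h (frechet_derivative f (at x) v) (g x))"
      using Suc.prems Ck_open_SucD[OF Suc.prems(1)] Ck_open_SucD[OF Suc.prems(2)]
      by (intro Ck_open_add[OF assms(1)] Suc.IH) simp_all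
  qed auto
qed

lemma linear_Basis_expansion:
  assumes "linear h"
  shows "h v = (\<Sum>b\<in>Basis. (v \<bullet> b) *\<^sub>R h b)"
  by (metis (mono_tags, lifting) assms euclidean_representation linear_scale linear_sum sum.cong)

lemma Ck_open_compose:
  assumes "open U" "open V" "f ` U \<subseteq> V" "Ck_open k U f" "Ck_open k V g"
  shows "Ck_open k U (\<lambda>x. g (f x))"
  using assms(4,5)
proof (induction k arbitrary: g)
  case 0
  then show ?case using assms(3) continuous_on_compose2 by auto
next
  case (Suc k)
  let ?f' = "\<lambda>x v. \<Sum>b\<in>Basis. (frechet_derivative f (at x) v \<bullet> b) *\<^sub>R frechet_derivative g (at (f x)) b"
  show ?case
  proof (rule Ck_open_SucI[OF assms(1), where f' = ?f'])
    fix x assume x: "x \<in> U"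
    then have g: "(g has_derivative frechet_derivative g (at (f x))) (at (f x))"
      using Suc.prems(2) assms(3) by (intro Ck_open_Suc_has_derivative) auto
    show "((\<lambda>x. g (f x)) has_derivative ?f' x) (at x)"
    proof (rule has_derivative_eq_rhs[OF has_derivative_compose[OF
            Ck_open_Suc_has_derivative[OF Suc.prems(1) x] g]], rule ext)
      show "frechet_derivative g (at (f x)) (frechet_derivative f (at x) v) = ?f' x v" for v
        by (rule linear_Basis_expansion[OF has_derivative_linear[OF g]])
    qed
  next
    fix v
    have "Ck_open k U (\<lambda>x. frechet_derivative g (at (f x)) b)" for b :: 'b
      using Suc.prems(2) by (intro Suc.IH Ck_open_SucD[OF Suc.prems(1)]) simp
    moreover have "Ck_open k U (\<lambda>x. frechet_derivative f (at x) v \<bullet> b)" for b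
      using Suc.prems by (intro Ck_open_bounded_linear[OF assms(1) bounded_linear_inner_left]) auto
    ultimately show "Ck_open k U (\<lambda>x. ?f' x v)"
      by (intro Ck_open_sum[OF assms(1)] Ck_open_bounded_bilinear[OF assms(1) bounded_bilinear_scaleR])
        auto
  qed
qed

text \<open>Smoothness on an open set. The openness of \<open>U\<close> is part of the notion, because \<open>Ck_open\<close> uses
derivatives in the full ambient space.\<close>

definition smooth_open :: "'a::euclidean_space set \<Rightarrow> ('a \<Rightarrow> 'b::real_normed_vector) \<Rightarrow> bool" where
  "smooth_open U f \<longleftrightarrow> open U \<and> (\<forall>k. Ck_open k U f)"

lemma smooth_open_compose:
  "smooth_open U f \<Longrightarrow> smooth_open V g \<Longrightarrow> f ` U \<subseteq> V \<Longrightarrow> smooth_open U (\<lambda>x. g (f x))"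
  unfolding smooth_open_def by (auto intro: Ck_open_compose)

lemma smooth_open_has_derivative:
  "smooth_open U f \<Longrightarrow> x \<in> U \<Longrightarrow> (f has_derivative frechet_derivative f (at x)) (at x)"
  unfolding smooth_open_def using Ck_open_Suc_has_derivative by blast

lemma smooth_open_frechet_derivative:
  "smooth_open U f \<Longrightarrow> smooth_open U (\<lambda>x. frechet_derivative f (at x) v)"
  unfolding smooth_open_def by (metis Ck_open.simps(2))

lemma smooth_open_const: "open U \<Longrightarrow> smooth_open U (\<lambda>x. c)"
  and smooth_open_id: "open U \<Longrightarrow> smooth_open U (\<lambda>x. x)"
  and smooth_open_add: "smooth_open U f \<Longrightarrow> smooth_open U g \<Longrightarrow> smooth_open U (\<lambda>x. f x + g x)"
  and smooth_open_bounded_linear: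
    "bounded_linear h \<Longrightarrow> smooth_open U f \<Longrightarrow> smooth_open U (\<lambda>x. h (f x))"
  and smooth_open_bounded_bilinear:
    "bounded_bilinear m \<Longrightarrow> smooth_open U f' \<Longrightarrow> smooth_open U g' \<Longrightarrow> smooth_open U (\<lambda>x. m (f' x) (g' x))"
  and smooth_open_cong:
    "smooth_open U f \<Longrightarrow> (\<And>x. x \<in> U \<Longrightarrow> f x = g x) \<Longrightarrow> smooth_open U g"
  and smooth_open_subset: "smooth_open U f \<Longrightarrow> open V \<Longrightarrow> V \<subseteq> U \<Longrightarrow> smooth_open V f"
  unfolding smooth_open_def
  by (auto intro: Ck_open_const Ck_open_id Ck_open_add Ck_open_bounded_linear
      Ck_open_bounded_bilinear Ck_open_cong Ck_open_subset)

lemma smooth_open_Un: "smooth_open U f \<Longrightarrow> smooth_open V f \<Longrightarrow> smooth_open (U \<union> V) f"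
  unfolding smooth_open_def by (metis Ck_open_local Un_iff open_Un)

text \<open>A function whose derivative is as smooth as the function itself is smooth; this covers solutions of
differential equations.\<close>

lemma smooth_open_bootstrap:
  assumes "open U" "\<And>x. x \<in> U \<Longrightarrow> (f has_derivative f' x) (at x)"
    "\<And>k v. Ck_open k U f \<Longrightarrow> Ck_open k U (\<lambda>x. f' x v)"
  shows "smooth_open U f"
proof -
  have "Ck_open k U f" for k
  proof (induction k)
    case 0
    show ?case using assms(2) by (auto intro!: continuous_at_imp_continuous_on has_derivative_continuous)
  next
    case (Suc k)
    show ?case using Ck_open_SucI[OF assms(1,2) assms(3)[OF Suc]] by blast
  qed
  then show ?thesis using assms(1) by (simp add: smooth_open_def)
qed

lemma smooth_open_inverse: "smooth_open (- {0}) (inverse :: real \<Rightarrow> real)"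
proof (rule smooth_open_bootstrap)
  show "(inverse has_derivative (\<lambda>v. - (inverse x * v * inverse x))) (at x)" if "x \<in> - {0}" for x :: real
    using has_derivative_inverse'[of x UNIV] that by auto
  show "Ck_open k (- {0}) (\<lambda>x. - (inverse x * v * inverse x))"
    if "Ck_open k (- {0}) (inverse :: real \<Rightarrow> real)" for k and v :: real
    using that
    by (intro Ck_open_bounded_linear[OF _ bounded_linear_minus[OF bounded_linear_ident]]
        Ck_open_bounded_bilinear[OF _ bounded_bilinear_mult] Ck_open_const) auto
qed auto

lemma smooth_open_exp: "smooth_open UNIV (exp :: real \<Rightarrow> real)"
proof (rule smooth_open_bootstrap)
  show "(exp has_derivative (\<lambda>v. exp x * v)) (at x)" for x :: real
    using DERIV_exp[of x] by (simp add: has_field_derivative_def)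
  show "Ck_open k UNIV (\<lambda>x. exp x * v)" if "Ck_open k UNIV (exp :: real \<Rightarrow> real)" for k and v :: real
    by (intro Ck_open_bounded_bilinear[OF _ bounded_bilinear_mult] Ck_open_const that open_UNIV)
qed auto

lemma smooth_open_cis: "smooth_open UNIV cis"
proof (rule smooth_open_bootstrap)
  show "(cis has_derivative (\<lambda>v. v *\<^sub>R (\<i> * cis x))) (at x)" for x :: real
    by (rule has_derivative_cis[OF has_derivative_ident])
  show "Ck_open k UNIV (\<lambda>x. v *\<^sub>R (\<i> * cis x))" if "Ck_open k UNIV cis" for k and v :: real
    by (intro Ck_open_bounded_bilinear[OF _ bounded_bilinear_mult] Ck_open_const that open_UNIV
        Ck_open_bounded_linear[OF _ bounded_linear_scaleR_right])
qed auto

lemma smooth_open_sqrt: "smooth_open {0<..} sqrt"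
proof (rule smooth_open_bootstrap)
  show "(sqrt has_derivative (\<lambda>v. inverse (sqrt x) / 2 * v)) (at x)" if "x \<in> {0<..}" for x :: real
    by (rule DERIV_real_sqrt[unfolded has_field_derivative_def]) (use that in simp)
  show "Ck_open k {0<..} (\<lambda>x. inverse (sqrt x) / 2 * v)"
    if sqrt: "Ck_open k {0<..} sqrt" for k and v :: real
  proof -
    have "Ck_open k {0<..} (\<lambda>x. inverse (sqrt x))"
      using smooth_open_inverse
      by (intro Ck_open_compose[OF _ _ _ sqrt, where g = inverse and V = "- {0}"])
        (auto simp: smooth_open_def)
    then show ?thesis
      unfolding divide_inverse
      by (intro Ck_open_bounded_bilinear[OF _ bounded_bilinear_mult] Ck_open_const open_greaterThan)
  qed
qed auto

section \<open>Smooth maps on arbitrary subsets\<close>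

lemma smooth_map_on_alt:
  "smooth_map_on A f \<longleftrightarrow> (\<forall>p\<in>A. \<exists>U F. p \<in> U \<and> smooth_open U F \<and> (\<forall>q\<in>U \<inter> A. F q = f q))"
  unfolding smooth_map_on_def smooth_open_def by blast

lemma smooth_map_onE:
  assumes "smooth_map_on A f" "p \<in> A"
  obtains U F where "p \<in> U" "smooth_open U F" "\<And>q. q \<in> U \<inter> A \<Longrightarrow> F q = f q"
  using assms unfolding smooth_map_on_alt by meson

lemma smooth_open_imp_smooth_map_on: "smooth_open U f \<Longrightarrow> A \<subseteq> U \<Longrightarrow> smooth_map_on A f"
  unfolding smooth_map_on_alt by blast

lemma smooth_map_on_const: "smooth_map_on A (\<lambda>x. c)"
  by (rule smooth_open_imp_smooth_map_on[OF smooth_open_const[OF open_UNIV]]) auto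

lemma smooth_map_on_id: "smooth_map_on A (\<lambda>x. x)"
  by (rule smooth_open_imp_smooth_map_on[OF smooth_open_id[OF open_UNIV]]) auto

lemma smooth_map_on_cong:
  "smooth_map_on A f \<Longrightarrow> (\<And>x. x \<in> A \<Longrightarrow> f x = g x) \<Longrightarrow> smooth_map_on A g"
  unfolding smooth_map_on_alt by fastforce

lemma smooth_map_on_subset: "smooth_map_on A f \<Longrightarrow> B \<subseteq> A \<Longrightarrow> smooth_map_on B f"
  unfolding smooth_map_on_alt by (meson IntD1 IntD2 IntI subsetD)

lemma smooth_map_on_bounded_bilinear:
  assumes "bounded_bilinear m" "smooth_map_on A f" "smooth_map_on A g"
  shows "smooth_map_on A (\<lambda>x. m (f x) (g x))"
  unfolding smooth_map_on_alt
proof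
  fix p assume p: "p \<in> A"
  obtain U F where U: "p \<in> U" "smooth_open U F" "\<And>q. q \<in> U \<inter> A \<Longrightarrow> F q = f q"
    using smooth_map_onE[OF assms(2) p] by metis
  obtain V G where V: "p \<in> V" "smooth_open V G" "\<And>q. q \<in> V \<inter> A \<Longrightarrow> G q = g q"
    using smooth_map_onE[OF assms(3) p] by metis
  have "open (U \<inter> V)" using U V by (auto simp: smooth_open_def)
  then have "smooth_open (U \<inter> V) (\<lambda>x. m (F x) (G x))"
    using U V by (intro smooth_open_bounded_bilinear[OF assms(1)]) (auto intro: smooth_open_subset)
  then show "\<exists>U F. p \<in> U \<and> smooth_open U F \<and> (\<forall>q\<in>U \<inter> A. F q = m (f q) (g q))"
    using U V by (intro exI[of _ "U \<inter> V"] exI[of _ "\<lambda>x. m (F x) (G x)"]) auto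
qed

lemma smooth_map_on_compose:
  assumes "smooth_map_on A f" "smooth_open V g" "f ` A \<subseteq> V"
  shows "smooth_map_on A (\<lambda>x. g (f x))"
  unfolding smooth_map_on_alt
proof
  fix p assume p: "p \<in> A"
  obtain U F where U: "p \<in> U" "smooth_open U F" "\<And>q. q \<in> U \<inter> A \<Longrightarrow> F q = f q"
    using smooth_map_onE[OF assms(1) p] by metis
  let ?W = "{x \<in> U. F x \<in> V}"
  have "continuous_on U F" using U(2) unfolding smooth_open_def by (metis Ck_open.simps(1))
  then have "open (U \<inter> F -` V)"
    using U(2) assms(2) by (intro continuous_open_preimage) (auto simp: smooth_open_def)
  moreover have "?W = U \<inter> F -` V" by auto
  ultimately have W: "open ?W" by simp
  have "smooth_open ?W (\<lambda>x. g (F x))"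
    using smooth_open_compose[OF smooth_open_subset[OF U(2) W] assms(2)] by auto
  moreover have "p \<in> ?W" using U p assms(3) by auto
  ultimately show "\<exists>U F. p \<in> U \<and> smooth_open U F \<and> (\<forall>q\<in>U \<inter> A. F q = g (f q))"
    using U by (intro exI[of _ ?W] exI[of _ "\<lambda>x. g (F x)"]) auto
qed

lemma smooth_map_on_bounded_linear:
  assumes "bounded_linear h" "smooth_map_on A f"
  shows "smooth_map_on A (\<lambda>x. h (f x))"
  unfolding smooth_map_on_alt
proof
  fix p assume p: "p \<in> A"
  obtain U F where U: "p \<in> U" "smooth_open U F" "\<And>q. q \<in> U \<inter> A \<Longrightarrow> F q = f q"
    using smooth_map_onE[OF assms(2) p] by metis
  then show "\<exists>U F. p \<in> U \<and> smooth_open U F \<and> (\<forall>q\<in>U \<inter> A. F q = h (f q))"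
    using smooth_open_bounded_linear[OF assms(1) U(2)]
    by (intro exI[of _ U] exI[of _ "\<lambda>x. h (F x)"]) auto
qed

lemma smooth_map_on_add:
  assumes "smooth_map_on A f" "smooth_map_on A g"
  shows "smooth_map_on A (\<lambda>x. f x + g x)"
  unfolding smooth_map_on_alt
proof
  fix p assume p: "p \<in> A"
  obtain U F where U: "p \<in> U" "smooth_open U F" "\<And>q. q \<in> U \<inter> A \<Longrightarrow> F q = f q"
    using smooth_map_onE[OF assms(1) p] by metis
  obtain V G where V: "p \<in> V" "smooth_open V G" "\<And>q. q \<in> V \<inter> A \<Longrightarrow> G q = g q"
    using smooth_map_onE[OF assms(2) p] by metis
  have "open (U \<inter> V)" using U V by (auto simp: smooth_open_def)
  then have "smooth_open (U \<inter> V) (\<lambda>x. F x + G x)"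
    using U V by (intro smooth_open_add) (auto intro: smooth_open_subset)
  then show "\<exists>U F. p \<in> U \<and> smooth_open U F \<and> (\<forall>q\<in>U \<inter> A. F q = f q + g q)"
    using U V by (intro exI[of _ "U \<inter> V"] exI[of _ "\<lambda>x. F x + G x"]) auto
qed

lemma smooth_map_on_sum:
  assumes "finite I" "\<And>i. i \<in> I \<Longrightarrow> smooth_map_on A (f i)"
  shows "smooth_map_on A (\<lambda>x. \<Sum>i\<in>I. f i x)"
  using assms
  by (induction I rule: finite_induct) (auto simp: smooth_map_on_const intro: smooth_map_on_add)

lemmas smooth_map_on_mult = smooth_map_on_bounded_bilinear[OF bounded_bilinear_mult]
lemmas smooth_map_on_scaleR = smooth_map_on_bounded_bilinear[OF bounded_bilinear_scaleR]
lemmas smooth_map_on_inner = smooth_map_on_bounded_bilinear[OF bounded_bilinear_inner]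
lemmas smooth_map_on_minus = smooth_map_on_bounded_linear[OF bounded_linear_minus[OF bounded_linear_ident]]

lemma smooth_map_on_diff:
  "smooth_map_on A f \<Longrightarrow> smooth_map_on A g \<Longrightarrow> smooth_map_on A (\<lambda>x. f x - g x)"
  using smooth_map_on_add[OF _ smooth_map_on_minus, of A f g] by simp

lemma smooth_map_on_inverse:
  fixes f :: "'a::euclidean_space \<Rightarrow> real"
  shows "smooth_map_on A f \<Longrightarrow> (\<And>x. x \<in> A \<Longrightarrow> f x \<noteq> 0) \<Longrightarrow> smooth_map_on A (\<lambda>x. inverse (f x))"
  by (rule smooth_map_on_compose[OF _ smooth_open_inverse]) auto

lemma smooth_map_on_divide:
  fixes f g :: "'a::euclidean_space \<Rightarrow> real"
  shows "smooth_map_on A f \<Longrightarrow> smooth_map_on A g \<Longrightarrow> (\<And>x. x \<in> A \<Longrightarrow> g x \<noteq> 0)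
    \<Longrightarrow> smooth_map_on A (\<lambda>x. f x / g x)"
  unfolding divide_inverse by (intro smooth_map_on_mult smooth_map_on_inverse)

lemma smooth_map_on_Pair:
  fixes f :: "'a::euclidean_space \<Rightarrow> 'b::real_normed_vector" and g :: "'a \<Rightarrow> 'c::real_normed_vector"
  assumes "smooth_map_on A f" "smooth_map_on A g"
  shows "smooth_map_on A (\<lambda>x. (f x, g x))"
proof -
  have "smooth_map_on A (\<lambda>x. (f x, 0::'c) + (0::'b, g x))"
    using assms by (intro smooth_map_on_add
        smooth_map_on_bounded_linear[OF bounded_linear_Pair[OF bounded_linear_ident bounded_linear_zero]]
        smooth_map_on_bounded_linear[OF bounded_linear_Pair[OF bounded_linear_zero bounded_linear_ident]])
  then show ?thesis by simp
qed

lemma smooth_open_openD: "smooth_open U f \<Longrightarrow> open U"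
  by (simp add: smooth_open_def)

section \<open>Derivatives along tangent vectors, and exterior derivatives\<close>

text \<open>The derivative within \<open>M\<close> need not be unique, so that \<open>frechet_derivative\<close> is only some derivative.\<close>

lemma has_derivative_frechet_within:
  "(f has_derivative D) (at p within M) \<Longrightarrow> (f has_derivative frechet_derivative f (at p within M)) (at p within M)"
  unfolding frechet_derivative_def by (rule someI[of "\<lambda>f'. (f has_derivative f') (at p within M)"])

text \<open>Any two derivatives of a map within \<open>M\<close> agree on tangent vectors of \<open>M\<close>, since both compute the
derivative along a curve in \<open>M\<close>. Hence \<open>dir_deriv\<close> can be computed from any of them.\<close>

lemma dir_deriv_eq:
  assumes p: "p \<in> M" and v: "v \<in> tangent_space M p"
    and f: "(f has_derivative f') (at p within M)"
  shows "dir_deriv M f p v = f' v"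
proof -
  obtain \<gamma> e where \<gamma>: "e > 0" "\<gamma> ` {-e<..<e} \<subseteq> M" "\<gamma> 0 = p"
    "(\<gamma> has_derivative (\<lambda>t. t *\<^sub>R v)) (at (0::real) within {-e<..<e})"
    using v unfolding tangent_space_def has_vector_derivative_def
    by (blast intro: has_derivative_at_withinI)
  have along: "((\<lambda>t. f (\<gamma> t)) has_derivative (\<lambda>t. h (t *\<^sub>R v))) (at 0)"
    if "(f has_derivative h) (at p within M)" for h
  proof -
    have "(f has_derivative h) (at (\<gamma> 0) within \<gamma> ` {-e<..<e})"
      using has_derivative_subset[OF that \<gamma>(2)] \<gamma>(3) by simp
    from has_derivative_in_compose[OF \<gamma>(4) this] show ?thesis
      using \<gamma>(1) by (simp add: at_within_open[of "0::real" "{-e<..<e}"])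
  qed
  have "(f has_derivative frechet_derivative f (at p within M)) (at p within M)"
    by (rule has_derivative_frechet_within[OF f])
  then have "(\<lambda>t::real. frechet_derivative f (at p within M) (t *\<^sub>R v)) = (\<lambda>t. f' (t *\<^sub>R v))"
    by (intro has_derivative_unique[OF along along] f)
  from fun_cong[OF this, of 1] show ?thesis by (simp add: dir_deriv_def)
qed

lemma has_derivative_local_extension:
  assumes "(F has_derivative D) (at p)" "open U" "p \<in> U" "p \<in> M" "\<And>q. q \<in> U \<inter> M \<Longrightarrow> F q = f q"
  shows "(f has_derivative D) (at p within M)"
proof -
  obtain d where "d > 0" "ball p d \<subseteq> U" using assms(2,3) openE by blast
  then show ?thesis
    using assms(4,5)
    by (intro has_derivative_transform_within[OF has_derivative_at_withinI[OF assms(1)], of d])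
      (auto simp: subset_eq dist_commute)
qed

lemma smooth_map_on_has_derivative:
  assumes "smooth_map_on M f" "p \<in> M"
  shows "(f has_derivative dir_deriv M f p) (at p within M)"
proof -
  obtain U F where U: "p \<in> U" "smooth_open U F" "\<And>q. q \<in> U \<inter> M \<Longrightarrow> F q = f q"
    using smooth_map_onE[OF assms] by metis
  have "(f has_derivative frechet_derivative F (at p)) (at p within M)"
    by (rule has_derivative_local_extension[OF smooth_open_has_derivative[OF U(2,1)]
          smooth_open_openD[OF U(2)] U(1) assms(2) U(3)])
  from has_derivative_frechet_within[OF this] show ?thesis unfolding dir_deriv_def .
qed

lemma linear_dir_deriv: "smooth_map_on M f \<Longrightarrow> p \<in> M \<Longrightarrow> linear (dir_deriv M f p)"
  by (rule has_derivative_linear[OF smooth_map_on_has_derivative])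

lemma smooth_map_on_dir_deriv:
  assumes f: "smooth_map_on M f" and X: "smooth_map_on M X"
    and tan: "\<And>p. p \<in> M \<Longrightarrow> X p \<in> tangent_space M p"
  shows "smooth_map_on M (\<lambda>p. dir_deriv M f p (X p))"
  unfolding smooth_map_on_alt
proof
  fix p assume p: "p \<in> M"
  obtain U F where U: "p \<in> U" "smooth_open U F" "\<And>q. q \<in> U \<inter> M \<Longrightarrow> F q = f q"
    using smooth_map_onE[OF f p] by metis
  let ?d = "\<lambda>q. \<Sum>b\<in>Basis. (X q \<bullet> b) *\<^sub>R frechet_derivative F (at q) b"
  have d: "?d q = dir_deriv M f q (X q)" if "q \<in> U \<inter> M" for q
  proof -
    have D: "(F has_derivative frechet_derivative F (at q)) (at q)"
      using smooth_open_has_derivative[OF U(2)] that by blast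
    have "(f has_derivative frechet_derivative F (at q)) (at q within M)"
      using that by (intro has_derivative_local_extension[OF D smooth_open_openD[OF U(2)]] U(3)) auto
    then show ?thesis
      using dir_deriv_eq[of q M "X q" f] tan that
        linear_Basis_expansion[OF has_derivative_linear[OF D], of "X q"] by auto
  qed
  have "smooth_map_on (U \<inter> M) ?d"
    by (intro smooth_map_on_sum smooth_map_on_scaleR smooth_map_on_inner smooth_map_on_const
        smooth_map_on_subset[OF X] smooth_open_imp_smooth_map_on[OF
          smooth_open_frechet_derivative[OF U(2)]]) auto
  then obtain V G where V: "p \<in> V" "smooth_open V G" "\<And>q. q \<in> V \<inter> (U \<inter> M) \<Longrightarrow> G q = ?d q"
    using smooth_map_onE[of "U \<inter> M" ?d p] p U(1) by blast
  have "open (U \<inter> V)" using U(2) V(2) by (intro open_Int smooth_open_openD)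
  then show "\<exists>U F. p \<in> U \<and> smooth_open U F \<and> (\<forall>q\<in>U \<inter> M. F q = dir_deriv M f q (X q))"
    using smooth_open_subset[OF V(2)] U(1) V(1,3) d by (intro exI[of _ "U \<inter> V"] exI[of _ G]) auto
qed

lemma dir_deriv_add:
  "smooth_map_on M f \<Longrightarrow> smooth_map_on M g \<Longrightarrow> p \<in> M \<Longrightarrow> v \<in> tangent_space M p
   \<Longrightarrow> dir_deriv M (\<lambda>q. f q + g q) p v = dir_deriv M f p v + dir_deriv M g p v"
  by (intro dir_deriv_eq has_derivative_add smooth_map_on_has_derivative)

lemma dir_deriv_bounded_bilinear:
  "bounded_bilinear m \<Longrightarrow> smooth_map_on M f \<Longrightarrow> smooth_map_on M g \<Longrightarrow> p \<in> M
   \<Longrightarrow> v \<in> tangent_space M p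
   \<Longrightarrow> dir_deriv M (\<lambda>q. m (f q) (g q)) p v = m (f p) (dir_deriv M g p v) + m (dir_deriv M f p v) (g p)"
  by (rule dir_deriv_eq[OF _ _ bounded_bilinear.FDERIV[OF _ smooth_map_on_has_derivative
          smooth_map_on_has_derivative]])

lemma dir_deriv_cong:
  assumes "smooth_map_on M f" "\<And>q. q \<in> M \<Longrightarrow> f q = g q" "p \<in> M" "v \<in> tangent_space M p"
  shows "dir_deriv M g p v = dir_deriv M f p v"
  using assms by (intro dir_deriv_eq
      has_derivative_transform[OF _ _ smooth_map_on_has_derivative[OF assms(1)]]) auto

lemma dir_deriv_vanishing:
  assumes "\<And>q. q \<in> M \<Longrightarrow> f q = 0" "p \<in> M" "v \<in> tangent_space M p"
  shows "dir_deriv M f p v = 0"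
  using dir_deriv_eq[OF assms(2,3), of f "\<lambda>_. 0"] assms
    has_derivative_transform[OF assms(2), of f "\<lambda>_. 0"] by auto

lemma smooth_map_on_Re: "smooth_map_on A f \<Longrightarrow> smooth_map_on A (\<lambda>x. Re (f x))"
  and smooth_map_on_Im: "smooth_map_on A f \<Longrightarrow> smooth_map_on A (\<lambda>x. Im (f x))"
  by (auto intro: smooth_map_on_bounded_linear bounded_linear_Re bounded_linear_Im)

lemma smooth_map_on_Complex:
  "smooth_map_on A a \<Longrightarrow> smooth_map_on A b \<Longrightarrow> smooth_map_on A (\<lambda>x. Complex (a x) (b x))"
  unfolding Complex_eq
  by (intro smooth_map_on_add smooth_map_on_mult smooth_map_on_const
      smooth_map_on_bounded_linear[OF bounded_linear_of_real])

text \<open>A smooth one-form along \<open>M\<close>, with real, complex or vector values. The form is linear on the whole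
ambient space, so that its smoothness can be tested on constant vectors.\<close>

definition smooth_form :: "'a::euclidean_space set \<Rightarrow> ('a \<Rightarrow> 'a \<Rightarrow> 'b::real_normed_vector) \<Rightarrow> bool" where
  "smooth_form M \<alpha> \<longleftrightarrow> (\<forall>p. linear (\<alpha> p)) \<and> (\<forall>v. smooth_map_on M (\<lambda>p. \<alpha> p v))"

text \<open>The exterior derivative, evaluated by extending both tangent vectors to constant fields of the ambient
space, which commute.\<close>

definition ext_deriv :: "'a::euclidean_space set \<Rightarrow> ('a \<Rightarrow> 'a \<Rightarrow> 'b::real_normed_vector) \<Rightarrow> 'a \<Rightarrow> 'a \<Rightarrow> 'a \<Rightarrow> 'b" where
  "ext_deriv M \<alpha> p u v = dir_deriv M (\<lambda>q. \<alpha> q v) p u - dir_deriv M (\<lambda>q. \<alpha> q u) p v"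

lemma smooth_form_linear:
  assumes "smooth_form M \<alpha>"
  shows "\<alpha> p (u + v) = \<alpha> p u + \<alpha> p v" "\<alpha> p (c *\<^sub>R u) = c *\<^sub>R \<alpha> p u" "\<alpha> p 0 = 0"
    "\<alpha> p (u - v) = \<alpha> p u - \<alpha> p v"
  using assms unfolding smooth_form_def by (auto simp: linear_add linear_scale linear_0 linear_diff)

lemma smooth_form_expand:
  assumes "smooth_form M \<alpha>"
  shows "\<alpha> p u = (\<Sum>b\<in>Basis. (u \<bullet> b) *\<^sub>R \<alpha> p b)"
  using assms unfolding smooth_form_def by (intro linear_Basis_expansion) simp

lemma smooth_form_apply:
  assumes "smooth_form M \<alpha>" "smooth_map_on M X"
  shows "smooth_map_on M (\<lambda>p. \<alpha> p (X p))"
  unfolding smooth_form_expand[OF assms(1), of _ "X _"]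
  using assms by (intro smooth_map_on_sum smooth_map_on_scaleR smooth_map_on_inner smooth_map_on_const)
    (auto simp: smooth_form_def)

lemma dir_deriv_form_apply:
  assumes \<alpha>: "smooth_form M \<alpha>" and Y: "smooth_map_on M Y" and p: "p \<in> M" and u: "u \<in> tangent_space M p"
  shows "dir_deriv M (\<lambda>q. \<alpha> q (Y q)) p u = dir_deriv M (\<lambda>q. \<alpha> q (Y p)) p u + \<alpha> p (dir_deriv M Y p u)"
proof -
  let ?D = "\<lambda>b. dir_deriv M (\<lambda>q. \<alpha> q b) p"
  have Db: "((\<lambda>q. \<alpha> q b) has_derivative ?D b) (at p within M)" for b
    using \<alpha> p by (intro smooth_map_on_has_derivative) (auto simp: smooth_form_def)
  have DY: "((\<lambda>q. Y q \<bullet> b) has_derivative (\<lambda>u. dir_deriv M Y p u \<bullet> b)) (at p within M)" for b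
    by (intro bounded_linear.has_derivative[OF bounded_linear_inner_left]
        smooth_map_on_has_derivative Y p)
  have "((\<lambda>q. \<Sum>b\<in>Basis. (Y q \<bullet> b) *\<^sub>R \<alpha> q b) has_derivative
      (\<lambda>u. \<Sum>b\<in>Basis. (Y p \<bullet> b) *\<^sub>R ?D b u + (dir_deriv M Y p u \<bullet> b) *\<^sub>R \<alpha> p b)) (at p within M)"
    by (intro has_derivative_sum has_derivative_scaleR Db DY)
  then have 1: "dir_deriv M (\<lambda>q. \<alpha> q (Y q)) p u =
      (\<Sum>b\<in>Basis. (Y p \<bullet> b) *\<^sub>R ?D b u + (dir_deriv M Y p u \<bullet> b) *\<^sub>R \<alpha> p b)"
    unfolding smooth_form_expand[OF \<alpha>, of _ "Y _"] by (rule dir_deriv_eq[OF p u])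
  have "((\<lambda>q. \<Sum>b\<in>Basis. (Y p \<bullet> b) *\<^sub>R \<alpha> q b) has_derivative
      (\<lambda>u. \<Sum>b\<in>Basis. (Y p \<bullet> b) *\<^sub>R ?D b u)) (at p within M)"
    by (intro has_derivative_sum has_derivative_scaleR_right Db)
  then have 2: "dir_deriv M (\<lambda>q. \<alpha> q (Y p)) p u = (\<Sum>b\<in>Basis. (Y p \<bullet> b) *\<^sub>R ?D b u)"
    unfolding smooth_form_expand[OF \<alpha>, of _ "Y _"] by (rule dir_deriv_eq[OF p u])
  show ?thesis
    unfolding 1 2 smooth_form_expand[OF \<alpha>, of p "dir_deriv M Y p u"] by (simp add: sum.distrib)
qed

lemma vector_fieldsD:
  assumes "X \<in> vector_fields M"
  shows "smooth_map_on M X" "p \<in> M \<Longrightarrow> X p \<in> tangent_space M p" "p \<notin> M \<Longrightarrow> X p = 0"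
  using assms unfolding vector_fields_def by auto

text \<open>Cartan's formula for the exterior derivative of a one-form.\<close>

lemma form_lie_bracket:
  assumes \<alpha>: "smooth_form M \<alpha>" and X: "X \<in> vector_fields M" and Y: "Y \<in> vector_fields M" and p: "p \<in> M"
  shows "\<alpha> p (lie_bracket M X Y p) =
    dir_deriv M (\<lambda>q. \<alpha> q (Y q)) p (X p) - dir_deriv M (\<lambda>q. \<alpha> q (X q)) p (Y p)
    - ext_deriv M \<alpha> p (X p) (Y p)"
  using dir_deriv_form_apply[OF \<alpha> vector_fieldsD(1)[OF Y] p vector_fieldsD(2)[OF X p]]
    dir_deriv_form_apply[OF \<alpha> vector_fieldsD(1)[OF X] p vector_fieldsD(2)[OF Y p]]
  by (simp add: lie_bracket_def p ext_deriv_def smooth_form_linear[OF \<alpha>])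

lemma smooth_map_on_ext_deriv:
  assumes \<alpha>: "smooth_form M \<alpha>" and X: "X \<in> vector_fields M" and Y: "Y \<in> vector_fields M"
  shows "smooth_map_on M (\<lambda>p. ext_deriv M \<alpha> p (X p) (Y p))"
proof (rule smooth_map_on_cong)
  note X' = vector_fieldsD(1,2)[OF X] and Y' = vector_fieldsD(1,2)[OF Y]
  show "smooth_map_on M (\<lambda>p. dir_deriv M (\<lambda>q. \<alpha> q (Y q)) p (X p) - dir_deriv M (\<lambda>q. \<alpha> q (X q)) p (Y p)
    - \<alpha> p (dir_deriv M Y p (X p) - dir_deriv M X p (Y p)))"
    by (intro smooth_map_on_diff smooth_map_on_dir_deriv smooth_form_apply[OF \<alpha>]
        smooth_map_on_dir_deriv[OF X'(1) Y'] smooth_map_on_dir_deriv[OF Y'(1) X'] X' Y')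
  show "dir_deriv M (\<lambda>q. \<alpha> q (Y q)) p (X p) - dir_deriv M (\<lambda>q. \<alpha> q (X q)) p (Y p)
    - \<alpha> p (dir_deriv M Y p (X p) - dir_deriv M X p (Y p)) = ext_deriv M \<alpha> p (X p) (Y p)"
    if "p \<in> M" for p
    using form_lie_bracket[OF \<alpha> X Y that] by (simp add: lie_bracket_def that)
qed

lemma ext_deriv_comb:
  fixes e :: "'i \<Rightarrow> 'a::euclidean_space"
  assumes \<alpha>: "smooth_form M \<alpha>" and p: "p \<in> M" and sub: "subspace (tangent_space M p)"
    and I: "finite I" and e: "\<And>i. i \<in> I \<Longrightarrow> e i \<in> tangent_space M p"
  shows "ext_deriv M \<alpha> p (\<Sum>i\<in>I. a i *\<^sub>R e i) (\<Sum>j\<in>I. b j *\<^sub>R e j) =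
    (\<Sum>i\<in>I. \<Sum>j\<in>I. (a i * b j) *\<^sub>R ext_deriv M \<alpha> p (e i) (e j))"
proof -
  let ?D = "\<lambda>b. dir_deriv M (\<lambda>q. \<alpha> q b) p"
  have sm: "smooth_map_on M (\<lambda>q. \<alpha> q b)" for b using \<alpha> by (auto simp: smooth_form_def)
  have D: "?D (\<Sum>j\<in>I. b j *\<^sub>R e j) (\<Sum>i\<in>I. a i *\<^sub>R e i) = (\<Sum>i\<in>I. \<Sum>j\<in>I. (a i * b j) *\<^sub>R ?D (e j) (e i))"
    for a b :: "'i \<Rightarrow> real"
  proof -
    have lin: "linear (\<alpha> q)" for q using \<alpha> by (simp add: smooth_form_def)
    have u: "(\<Sum>i\<in>I. a i *\<^sub>R e i) \<in> tangent_space M p"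
      using e by (intro subspace_sum[OF sub] subspace_scale[OF sub])
    have "((\<lambda>q. \<Sum>j\<in>I. b j *\<^sub>R \<alpha> q (e j)) has_derivative (\<lambda>u. \<Sum>j\<in>I. b j *\<^sub>R ?D (e j) u)) (at p within M)"
      by (intro has_derivative_sum has_derivative_scaleR_right smooth_map_on_has_derivative sm p)
    moreover have "(\<lambda>q. \<alpha> q (\<Sum>j\<in>I. b j *\<^sub>R e j)) = (\<lambda>q. \<Sum>j\<in>I. b j *\<^sub>R \<alpha> q (e j))"
      by (simp add: linear_sum[OF lin] linear_scale[OF lin])
    ultimately have "?D (\<Sum>j\<in>I. b j *\<^sub>R e j) (\<Sum>i\<in>I. a i *\<^sub>R e i)
        = (\<Sum>j\<in>I. b j *\<^sub>R ?D (e j) (\<Sum>i\<in>I. a i *\<^sub>R e i))"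
      by (simp only: dir_deriv_eq[OF p u])
    also have "\<dots> = (\<Sum>j\<in>I. \<Sum>i\<in>I. (a i * b j) *\<^sub>R ?D (e j) (e i))"
      by (simp add: linear_sum[OF linear_dir_deriv[OF sm p]] linear_scale[OF linear_dir_deriv[OF sm p]]
          scaleR_sum_right mult.commute)
    finally show ?thesis by (subst sum.swap)
  qed
  show ?thesis
    unfolding ext_deriv_def D[of b a] D[of a b]
    by (subst (2) sum.swap) (simp add: sum_subtractf scaleR_diff_right mult.commute)
qed

lemma ext_deriv_swap: "ext_deriv M \<alpha> p v u = - ext_deriv M \<alpha> p u v"
  and ext_deriv_same: "ext_deriv M \<alpha> p u u = 0"
  by (simp_all add: ext_deriv_def)

section \<open>Conformal products from coframes\<close>

text \<open>A three-dimensional submanifold with a coframe \<open>(\<alpha>, \<omega>) : TM \<rightarrow> \<real> \<times> \<complex>\<close>, its dual frame \<open>E0, E1, E2\<close>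
(dual to \<open>1\<close> in the real factor and to \<open>1, \<i>\<close> in the complex factor), and the integrability conditions
\<open>\<alpha> \<and> d\<alpha> = 0\<close> and \<open>\<omega> \<and> d\<omega> = 0\<close> in terms of that frame. Linearity of the tangent spaces and closure
of tangent fields under the bracket hold for all embedded submanifolds; they are assumed so that they
need only be proved for the submanifold in question.\<close>

locale integrable_coframe =
  fixes M :: "'a::euclidean_space set"
    and \<alpha> :: "'a \<Rightarrow> 'a \<Rightarrow> real" and \<omega> :: "'a \<Rightarrow> 'a \<Rightarrow> complex"
    and E0 E1 E2 :: "'a \<Rightarrow> 'a"
  assumes subspace_tangent: "p \<in> M \<Longrightarrow> subspace (tangent_space M p)"
    and bracket_tangent: "X \<in> vector_fields M \<Longrightarrow> Y \<in> vector_fields M \<Longrightarrow> p \<in> M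
          \<Longrightarrow> lie_bracket M X Y p \<in> tangent_space M p"
    and form\<alpha>: "smooth_form M \<alpha>" and form\<omega>: "smooth_form M \<omega>"
    and E: "E0 \<in> vector_fields M" "E1 \<in> vector_fields M" "E2 \<in> vector_fields M"
    and dual: "p \<in> M \<Longrightarrow> \<alpha> p (E0 p) = 1" "p \<in> M \<Longrightarrow> \<alpha> p (E1 p) = 0" "p \<in> M \<Longrightarrow> \<alpha> p (E2 p) = 0"
      "p \<in> M \<Longrightarrow> \<omega> p (E0 p) = 0" "p \<in> M \<Longrightarrow> \<omega> p (E1 p) = 1" "p \<in> M \<Longrightarrow> \<omega> p (E2 p) = \<i>"
    and coframe_inj: "p \<in> M \<Longrightarrow> u \<in> tangent_space M p \<Longrightarrow> \<alpha> p u = 0 \<Longrightarrow> \<omega> p u = 0 \<Longrightarrow> u = 0"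
    and integrable\<alpha>: "p \<in> M \<Longrightarrow> ext_deriv M \<alpha> p (E1 p) (E2 p) = 0"
    and integrable\<omega>: "p \<in> M \<Longrightarrow> ext_deriv M \<omega> p (E0 p) (E2 p) = \<i> * ext_deriv M \<omega> p (E0 p) (E1 p)"
begin

lemmas E_tangent = E[THEN vector_fieldsD(2)]
lemmas E_smooth = E[THEN vector_fieldsD(1)]
lemmas E_off = E[THEN vector_fieldsD(3)]
lemmas \<alpha>_linear = smooth_form_linear[OF form\<alpha>]
lemmas \<omega>_linear = smooth_form_linear[OF form\<omega>]
lemmas \<alpha>_smooth = smooth_form_apply[OF form\<alpha> vector_fieldsD(1)]
lemmas \<omega>_smooth = smooth_form_apply[OF form\<omega> vector_fieldsD(1)]

text \<open>The inverse of the coframe at \<open>p\<close>.\<close>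

definition lift :: "'a \<Rightarrow> real \<Rightarrow> complex \<Rightarrow> 'a" where
  "lift p a c = a *\<^sub>R E0 p + Re c *\<^sub>R E1 p + Im c *\<^sub>R E2 p"

lemma lift_tangent: "p \<in> M \<Longrightarrow> lift p a c \<in> tangent_space M p"
  unfolding lift_def using subspace_tangent E_tangent
  by (intro subspace_add subspace_scale) auto

lemma coframe_lift: "p \<in> M \<Longrightarrow> \<alpha> p (lift p a c) = a" "p \<in> M \<Longrightarrow> \<omega> p (lift p a c) = c"
  by (simp_all add: lift_def \<alpha>_linear \<omega>_linear dual complex_eq_iff)

lemma tangent_eqI:
  assumes "p \<in> M" "u \<in> tangent_space M p" "v \<in> tangent_space M p" "\<alpha> p u = \<alpha> p v" "\<omega> p u = \<omega> p v"
  shows "u = v"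
  using coframe_inj[OF assms(1) subspace_diff[OF subspace_tangent[OF assms(1)] assms(2,3)]] assms(4,5)
  by (simp add: \<alpha>_linear \<omega>_linear)

lemma lift_coframe: "p \<in> M \<Longrightarrow> u \<in> tangent_space M p \<Longrightarrow> lift p (\<alpha> p u) (\<omega> p u) = u"
  by (rule tangent_eqI[of p]) (simp_all add: lift_tangent coframe_lift)

lemma lift_off: "p \<notin> M \<Longrightarrow> lift p a c = 0"
  by (simp add: lift_def E_off)

lemma smooth_lift:
  "smooth_map_on M a \<Longrightarrow> smooth_map_on M c \<Longrightarrow> smooth_map_on M (\<lambda>p. lift p (a p) (c p))"
  unfolding lift_def
  by (intro smooth_map_on_add smooth_map_on_scaleR E_smooth smooth_map_on_Re smooth_map_on_Im)

lemma ext_deriv_frame: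
  assumes \<gamma>: "smooth_form M \<gamma>" and p: "p \<in> M"
    and u: "u \<in> tangent_space M p" and v: "v \<in> tangent_space M p"
  shows "ext_deriv M \<gamma> p u v =
     (\<alpha> p u * Re (\<omega> p v) - Re (\<omega> p u) * \<alpha> p v) *\<^sub>R ext_deriv M \<gamma> p (E0 p) (E1 p)
   + (\<alpha> p u * Im (\<omega> p v) - Im (\<omega> p u) * \<alpha> p v) *\<^sub>R ext_deriv M \<gamma> p (E0 p) (E2 p)
   + (Re (\<omega> p u) * Im (\<omega> p v) - Im (\<omega> p u) * Re (\<omega> p v)) *\<^sub>R ext_deriv M \<gamma> p (E1 p) (E2 p)"
proof -
  \<comment> \<open>both vectors are expanded in the frame, indexed by \<open>0, 1, 2\<close>\<close>
  define e where "e = (\<lambda>i::nat. if i = 0 then E0 p else if i = 1 then E1 p else E2 p)"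
  define k where "k = (\<lambda>w i::nat. if i = 0 then \<alpha> p w else if i = 1 then Re (\<omega> p w) else Im (\<omega> p w))"
  have exp: "w = (\<Sum>i\<in>{0,1,2}. k w i *\<^sub>R e i)" if "w \<in> tangent_space M p" for w
    using lift_coframe[OF p that] by (simp add: lift_def k_def e_def add.assoc)
  have "ext_deriv M \<gamma> p u v = (\<Sum>i\<in>{0,1,2}. \<Sum>j\<in>{0,1,2}. (k u i * k v j) *\<^sub>R ext_deriv M \<gamma> p (e i) (e j))"
    by (subst exp[OF u], subst exp[OF v], rule ext_deriv_comb[OF \<gamma> p subspace_tangent[OF p]])
      (auto simp: e_def E_tangent p)
  then show ?thesis
    using ext_deriv_swap[of M \<gamma> p "E1 p" "E0 p"] ext_deriv_swap[of M \<gamma> p "E2 p" "E0 p"]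
      ext_deriv_swap[of M \<gamma> p "E2 p" "E1 p"]
    by (simp add: ext_deriv_same k_def e_def algebra_simps)
qed

text \<open>The values of the connection form \<open>B\<close> on \<open>E1\<close> and \<open>E2\<close>. The real parts are forced by
\<open>d\<alpha>(E0, -) = Re B\<close> on the kernel of \<open>\<alpha>\<close>, and the imaginary parts by
\<open>d\<omega>(E1, E2) = B(E2) - \<i> B(E1)\<close>.\<close>

definition conn1 :: "'a \<Rightarrow> complex" where
  "conn1 p = Complex (ext_deriv M \<alpha> p (E0 p) (E1 p))
     (Re (ext_deriv M \<omega> p (E1 p) (E2 p)) - ext_deriv M \<alpha> p (E0 p) (E2 p))"

definition conn2 :: "'a \<Rightarrow> complex" where
  "conn2 p = Complex (ext_deriv M \<alpha> p (E0 p) (E2 p))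
     (Im (ext_deriv M \<omega> p (E1 p) (E2 p)) + ext_deriv M \<alpha> p (E0 p) (E1 p))"

text \<open>The connection form \<open>B\<close>. Its value \<open>- d\<omega>(E0, E1)\<close> on \<open>E0\<close> is forced by \<open>d\<omega> = - B \<and> \<omega>\<close>.\<close>

definition conn_form :: "'a \<Rightarrow> 'a \<Rightarrow> complex" where
  "conn_form p u = - (\<alpha> p u *\<^sub>R ext_deriv M \<omega> p (E0 p) (E1 p))
     + Re (\<omega> p u) *\<^sub>R conn1 p + Im (\<omega> p u) *\<^sub>R conn2 p"

lemma conn_form_linear:
  "conn_form p (u + v) = conn_form p u + conn_form p v"
  "conn_form p (c *\<^sub>R u) = c *\<^sub>R conn_form p u"
  by (simp_all add: conn_form_def \<alpha>_linear \<omega>_linear algebra_simps)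

lemma conn_form_smooth:
  assumes "X \<in> vector_fields M"
  shows "smooth_map_on M (\<lambda>p. conn_form p (X p))"
  unfolding conn_form_def conn1_def conn2_def
  by (intro smooth_map_on_add smooth_map_on_minus smooth_map_on_scaleR smooth_map_on_Complex
      smooth_map_on_Re smooth_map_on_Im smooth_map_on_diff \<alpha>_smooth \<omega>_smooth
      smooth_map_on_ext_deriv form\<alpha> form\<omega> E assms)

text \<open>The equations \<open>d\<alpha> = - Re B \<and> \<alpha>\<close> and \<open>d\<omega> = - B \<and> \<omega>\<close>, which express that the connection has no
torsion. This is where integrability enters.\<close>

lemma structure_equation_\<alpha>:
  assumes "p \<in> M" "u \<in> tangent_space M p" "v \<in> tangent_space M p"
  shows "ext_deriv M \<alpha> p u v = Re (conn_form p v) * \<alpha> p u - Re (conn_form p u) * \<alpha> p v"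
  unfolding ext_deriv_frame[OF form\<alpha> assms] integrable\<alpha>[OF assms(1)]
  by (simp add: conn_form_def conn1_def conn2_def algebra_simps)

lemma structure_equation_\<omega>:
  assumes "p \<in> M" "u \<in> tangent_space M p" "v \<in> tangent_space M p"
  shows "ext_deriv M \<omega> p u v = conn_form p v * \<omega> p u - conn_form p u * \<omega> p v"
  unfolding ext_deriv_frame[OF form\<omega> assms] integrable\<omega>[OF assms(1)]
  by (simp add: conn_form_def conn1_def conn2_def complex_eq_iff algebra_simps)

text \<open>The metric \<open>|\<omega>|\<^sup>2 + \<alpha>\<^sup>2\<close>.\<close>

definition metric :: "'a \<Rightarrow> 'a \<Rightarrow> 'a \<Rightarrow> real" where
  "metric p u v = \<omega> p u \<bullet> \<omega> p v + \<alpha> p u * \<alpha> p v"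

text \<open>The connection that is diagonal in the coframe, with connection form \<open>Re B\<close> on the real factor and
\<open>B\<close> on the complex factor.\<close>

definition weyl :: "('a \<Rightarrow> 'a) \<Rightarrow> ('a \<Rightarrow> 'a) \<Rightarrow> 'a \<Rightarrow> 'a" where
  "weyl X Y p = lift p
     (dir_deriv M (\<lambda>q. \<alpha> q (Y q)) p (X p) + Re (conn_form p (X p)) * \<alpha> p (Y p))
     (dir_deriv M (\<lambda>q. \<omega> q (Y q)) p (X p) + conn_form p (X p) * \<omega> p (Y p))"

lemma \<alpha>_weyl: "p \<in> M \<Longrightarrow> \<alpha> p (weyl X Y p) =
    dir_deriv M (\<lambda>q. \<alpha> q (Y q)) p (X p) + Re (conn_form p (X p)) * \<alpha> p (Y p)"
  and \<omega>_weyl: "p \<in> M \<Longrightarrow> \<omega> p (weyl X Y p) =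
    dir_deriv M (\<lambda>q. \<omega> q (Y q)) p (X p) + conn_form p (X p) * \<omega> p (Y p)"
  by (simp_all add: weyl_def coframe_lift)

lemma weyl_field:
  assumes X: "X \<in> vector_fields M" and Y: "Y \<in> vector_fields M"
  shows "weyl X Y \<in> vector_fields M"
proof -
  have "smooth_map_on M (weyl X Y)"
    unfolding weyl_def
    by (intro smooth_lift smooth_map_on_add smooth_map_on_mult smooth_map_on_dir_deriv
        smooth_map_on_Re conn_form_smooth \<alpha>_smooth \<omega>_smooth assms vector_fieldsD(1)[OF X] vector_fieldsD(2)[OF X])
  then show ?thesis
    unfolding vector_fields_def by (simp add: weyl_def lift_tangent lift_off)
qed

lemma vector_fields_add:
  "X \<in> vector_fields M \<Longrightarrow> Y \<in> vector_fields M \<Longrightarrow> (\<lambda>p. X p + Y p) \<in> vector_fields M"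
  using subspace_tangent by (auto simp: vector_fields_def intro: smooth_map_on_add subspace_add)

lemma vector_fields_scale:
  "smooth_map_on M \<phi> \<Longrightarrow> X \<in> vector_fields M \<Longrightarrow> (\<lambda>p. \<phi> p *\<^sub>R X p) \<in> vector_fields M"
  using subspace_tangent by (auto simp: vector_fields_def intro: smooth_map_on_scaleR subspace_scale)

lemma field_eqI:
  assumes "\<And>p. p \<in> M \<Longrightarrow> \<alpha> p (X p) = \<alpha> p (Y p)" "\<And>p. p \<in> M \<Longrightarrow> \<omega> p (X p) = \<omega> p (Y p)"
    "X \<in> vector_fields M" "Y \<in> vector_fields M"
  shows "X = Y"
proof
  fix p show "X p = Y p"
    using tangent_eqI[of p "X p" "Y p"] assms vector_fieldsD(2,3)[of X M p] vector_fieldsD(2,3)[of Y M p]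
    by (cases "p \<in> M") auto
qed

lemma linear_connection_weyl: "linear_connection M weyl"
  unfolding linear_connection_def
proof (intro conjI ballI allI impI)
  fix X X' Y Y' :: "'a \<Rightarrow> 'a" and \<phi> :: "'a \<Rightarrow> real"
  assume X: "X \<in> vector_fields M" and Y: "Y \<in> vector_fields M"
  note lin = linear_dir_deriv[OF \<alpha>_smooth[OF Y]] linear_dir_deriv[OF \<omega>_smooth[OF Y]]
  note tan = vector_fieldsD(2)[OF X]
  show "weyl X Y \<in> vector_fields M" by (rule weyl_field[OF X Y])
  show "weyl (\<lambda>p. X p + X' p) Y = (\<lambda>p. weyl X Y p + weyl X' Y p)" if X': "X' \<in> vector_fields M"
    by (rule field_eqI)
      (auto simp: \<alpha>_weyl \<omega>_weyl \<alpha>_linear \<omega>_linear conn_form_linear lin[THEN linear_add] algebra_simps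
        intro!: weyl_field vector_fields_add X Y X')
  show "weyl X (\<lambda>p. Y p + Y' p) = (\<lambda>p. weyl X Y p + weyl X Y' p)" if Y': "Y' \<in> vector_fields M"
    by (rule field_eqI)
      (simp_all add: \<alpha>_weyl \<omega>_weyl \<alpha>_linear \<omega>_linear tan
        dir_deriv_add[OF \<alpha>_smooth[OF Y] \<alpha>_smooth[OF Y']] dir_deriv_add[OF \<omega>_smooth[OF Y] \<omega>_smooth[OF Y']]
        distrib_left weyl_field vector_fields_add X Y Y')
  assume \<phi>: "smooth_map_on M \<phi>"
  show "weyl (\<lambda>p. \<phi> p *\<^sub>R X p) Y = (\<lambda>p. \<phi> p *\<^sub>R weyl X Y p)"
    by (rule field_eqI)
      (auto simp: \<alpha>_weyl \<omega>_weyl \<alpha>_linear \<omega>_linear conn_form_linear lin[THEN linear_scale] algebra_simps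
        intro!: weyl_field vector_fields_scale X Y \<phi>)
  have d: "(\<lambda>p. dir_deriv M \<phi> p (X p) *\<^sub>R Y p + \<phi> p *\<^sub>R weyl X Y p) \<in> vector_fields M"
    using \<phi> X Y by (intro vector_fields_add vector_fields_scale weyl_field smooth_map_on_dir_deriv)
      (auto dest: vector_fieldsD)
  show "weyl X (\<lambda>p. \<phi> p *\<^sub>R Y p) = (\<lambda>p. dir_deriv M \<phi> p (X p) *\<^sub>R Y p + \<phi> p *\<^sub>R weyl X Y p)"
    by (rule field_eqI[OF _ _ weyl_field[OF X vector_fields_scale[OF \<phi> Y]] d])
      (auto simp: \<alpha>_weyl \<omega>_weyl \<alpha>_linear \<omega>_linear tan algebra_simps
        dir_deriv_bounded_bilinear[OF bounded_bilinear_mult \<phi> \<alpha>_smooth[OF Y]]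
        dir_deriv_bounded_bilinear[OF bounded_bilinear_scaleR \<phi> \<omega>_smooth[OF Y]])
qed

lemma torsion_free_weyl: "torsion_free M weyl"
  unfolding torsion_free_def
proof (intro ballI)
  fix X Y p
  assume X: "X \<in> vector_fields M" and Y: "Y \<in> vector_fields M" and p: "p \<in> M"
  note tan = vector_fieldsD(2)[OF X p] vector_fieldsD(2)[OF Y p]
  show "weyl X Y p - weyl Y X p = lie_bracket M X Y p"
  proof (rule tangent_eqI[OF p _ bracket_tangent[OF X Y p]])
    show "weyl X Y p - weyl Y X p \<in> tangent_space M p"
      using subspace_diff[OF subspace_tangent[OF p]] by (simp add: weyl_def lift_tangent p)
    show "\<alpha> p (weyl X Y p - weyl Y X p) = \<alpha> p (lie_bracket M X Y p)"
      by (simp add: \<alpha>_linear \<alpha>_weyl p form_lie_bracket[OF form\<alpha> X Y p] structure_equation_\<alpha>[OF p tan])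
    show "\<omega> p (weyl X Y p - weyl Y X p) = \<omega> p (lie_bracket M X Y p)"
      by (simp add: \<omega>_linear \<omega>_weyl p form_lie_bracket[OF form\<omega> X Y p] structure_equation_\<omega>[OF p tan])
  qed
qed

lemma metric_smooth:
  "X \<in> vector_fields M \<Longrightarrow> Y \<in> vector_fields M \<Longrightarrow> smooth_map_on M (\<lambda>p. metric p (X p) (Y p))"
  unfolding metric_def
  by (intro smooth_map_on_add smooth_map_on_mult smooth_map_on_inner \<alpha>_smooth \<omega>_smooth)

lemma riemannian_metric: "riemannian_metric M metric"
  unfolding riemannian_metric_def
proof (intro conjI ballI allI impI)
  fix p u v w :: 'a and a :: real
  show "metric p (u + v) w = metric p u w + metric p v w"
    "metric p (a *\<^sub>R u) w = a * metric p u w" "metric p u v = metric p v u"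
    by (simp_all add: metric_def \<alpha>_linear \<omega>_linear inner_left_distrib inner_commute algebra_simps)
  assume "p \<in> M" "u \<in> tangent_space M p" "u \<noteq> 0"
  then have "\<omega> p u \<noteq> 0 \<or> \<alpha> p u \<noteq> 0" using coframe_inj by blast
  then show "metric p u u > 0"
    unfolding metric_def by (metis add_nonneg_pos add_pos_nonneg inner_ge_zero inner_gt_zero_iff
        not_real_square_gt_zero zero_le_square)
qed (rule metric_smooth)

text \<open>The connection scales the metric with Lee form \<open>Re B\<close>: both diagonal entries of the connection form
have the same real part.\<close>

lemma dir_deriv_metric:
  assumes X: "X \<in> vector_fields M" and Y: "Y \<in> vector_fields M" and Z: "Z \<in> vector_fields M" and p: "p \<in> M"
  shows "dir_deriv M (\<lambda>q. metric q (Y q) (Z q)) p (X p) =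
    metric p (weyl X Y p) (Z p) + metric p (Y p) (weyl X Z p)
      - 2 * Re (conn_form p (X p)) * metric p (Y p) (Z p)"
proof -
  note tan = vector_fieldsD(2)[OF X p]
  have "dir_deriv M (\<lambda>q. metric q (Y q) (Z q)) p (X p) =
    \<omega> p (Y p) \<bullet> dir_deriv M (\<lambda>q. \<omega> q (Z q)) p (X p) + dir_deriv M (\<lambda>q. \<omega> q (Y q)) p (X p) \<bullet> \<omega> p (Z p)
    + (\<alpha> p (Y p) * dir_deriv M (\<lambda>q. \<alpha> q (Z q)) p (X p) + dir_deriv M (\<lambda>q. \<alpha> q (Y q)) p (X p) * \<alpha> p (Z p))"
    unfolding metric_def
    using dir_deriv_add[OF smooth_map_on_inner[OF \<omega>_smooth[OF Y] \<omega>_smooth[OF Z]]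
         smooth_map_on_mult[OF \<alpha>_smooth[OF Y] \<alpha>_smooth[OF Z]] p tan]
       dir_deriv_bounded_bilinear[OF bounded_bilinear_inner \<omega>_smooth[OF Y] \<omega>_smooth[OF Z] p tan]
       dir_deriv_bounded_bilinear[OF bounded_bilinear_mult \<alpha>_smooth[OF Y] \<alpha>_smooth[OF Z] p tan]
    by simp
  then show ?thesis
    by (simp add: metric_def \<alpha>_weyl \<omega>_weyl p inner_complex_def algebra_simps)
qed

lemma conformally_compatible_weyl: "conformally_compatible M (conformal_class M metric) weyl"
  unfolding conformally_compatible_def
proof
  fix h assume "h \<in> conformal_class M metric"
  then obtain \<phi> where \<phi>: "smooth_map_on M \<phi>" "\<And>p. p \<in> M \<Longrightarrow> \<phi> p > 0"
    and h: "\<And>p u v. p \<in> M \<Longrightarrow> u \<in> tangent_space M p \<Longrightarrow> v \<in> tangent_space M p \<Longrightarrow> h p u v = \<phi> p * metric p u v"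
    unfolding conformal_class_def by blast
  \<comment> \<open>passing from \<open>g\<close> to \<open>\<phi> g\<close> changes the Lee form by \<open>- d\<phi> / (2 \<phi>)\<close>\<close>
  let ?\<theta> = "\<lambda>p u. Re (conn_form p u) - dir_deriv M \<phi> p u / (2 * \<phi> p)"
  show "\<exists>\<theta>. one_form M \<theta> \<and> (\<forall>X\<in>vector_fields M. \<forall>Y\<in>vector_fields M. \<forall>Z\<in>vector_fields M. \<forall>p\<in>M.
      cov_deriv_metric M weyl h X Y Z p = - 2 * \<theta> p (X p) * h p (Y p) (Z p))"
  proof (intro exI[of _ ?\<theta>] conjI ballI)
    show "one_form M ?\<theta>"
      unfolding one_form_def
    proof (intro conjI ballI allI)
      fix p u v :: 'a and a :: real assume p: "p \<in> M"
      note lin = linear_dir_deriv[OF \<phi>(1) p]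
      show "?\<theta> p (u + v) = ?\<theta> p u + ?\<theta> p v" "?\<theta> p (a *\<^sub>R u) = a * ?\<theta> p u"
        by (simp_all add: conn_form_linear lin[THEN linear_add] lin[THEN linear_scale]
            algebra_simps add_divide_distrib)
    next
      fix X assume X: "X \<in> vector_fields M"
      show "smooth_map_on M (\<lambda>p. ?\<theta> p (X p))"
        using \<phi>(2) by (intro smooth_map_on_diff smooth_map_on_Re conn_form_smooth X smooth_map_on_divide
            smooth_map_on_dir_deriv \<phi>(1) vector_fieldsD[OF X] smooth_map_on_mult smooth_map_on_const) fastforce+
    qed
    fix X Y Z p
    assume X: "X \<in> vector_fields M" and Y: "Y \<in> vector_fields M" and Z: "Z \<in> vector_fields M" and p: "p \<in> M"
    note tan = vector_fieldsD(2)[OF X p]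
    have "dir_deriv M (\<lambda>q. h q (Y q) (Z q)) p (X p) = dir_deriv M (\<lambda>q. \<phi> q * metric q (Y q) (Z q)) p (X p)"
      by (rule dir_deriv_cong[OF smooth_map_on_mult[OF \<phi>(1) metric_smooth[OF Y Z]] _ p tan])
        (simp add: h vector_fieldsD(2)[OF Y] vector_fieldsD(2)[OF Z])
    also have "\<dots> = \<phi> p * dir_deriv M (\<lambda>q. metric q (Y q) (Z q)) p (X p) + dir_deriv M \<phi> p (X p) * metric p (Y p) (Z p)"
      by (rule dir_deriv_bounded_bilinear[OF bounded_bilinear_mult \<phi>(1) metric_smooth[OF Y Z] p tan])
    finally have "cov_deriv_metric M weyl h X Y Z p =
        dir_deriv M \<phi> p (X p) * metric p (Y p) (Z p) - 2 * Re (conn_form p (X p)) * \<phi> p * metric p (Y p) (Z p)"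
      by (simp add: cov_deriv_metric_def dir_deriv_metric[OF X Y Z p] h p vector_fieldsD(2)[OF Y p]
          vector_fieldsD(2)[OF Z p] vector_fieldsD(2)[OF weyl_field[OF X Y] p]
          vector_fieldsD(2)[OF weyl_field[OF X Z] p] algebra_simps)
    also have "\<dots> = - 2 * ?\<theta> p (X p) * h p (Y p) (Z p)"
      using \<phi>(2)[OF p]
      by (simp add: h p vector_fieldsD(2)[OF Y p] vector_fieldsD(2)[OF Z p] field_simps)
    finally show "cov_deriv_metric M weyl h X Y Z p = - 2 * ?\<theta> p (X p) * h p (Y p) (Z p)" .
  qed
qed

lemma weyl_connection: "weyl_connection M (conformal_class M metric) weyl"
  by (simp add: weyl_connection_def linear_connection_weyl torsion_free_weyl conformally_compatible_weyl)

text \<open>The kernels of \<open>\<alpha>\<close> and of \<open>\<omega>\<close> in the tangent bundle.\<close>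

definition T1 :: "'a \<Rightarrow> 'a set" where "T1 p = {u \<in> tangent_space M p. \<alpha> p u = 0}"
definition T2 :: "'a \<Rightarrow> 'a set" where "T2 p = {u \<in> tangent_space M p. \<omega> p u = 0}"

lemma T1_span: "p \<in> M \<Longrightarrow> T1 p = span {E1 p, E2 p}"
proof
  assume p: "p \<in> M"
  show "T1 p \<subseteq> span {E1 p, E2 p}"
  proof
    fix u assume "u \<in> T1 p"
    then have "u = Re (\<omega> p u) *\<^sub>R E1 p + Im (\<omega> p u) *\<^sub>R E2 p"
      using lift_coframe[OF p, of u] by (simp add: T1_def lift_def)
    then show "u \<in> span {E1 p, E2 p}"
      by (metis insertI1 insert_commute span_add span_base span_scale)
  qed
  have "subspace (T1 p)"
    using subspace_tangent[OF p] by (auto simp: T1_def subspace_def \<alpha>_linear)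
  then show "span {E1 p, E2 p} \<subseteq> T1 p"
    using p E_tangent dual by (intro span_minimal) (auto simp: T1_def)
qed

lemma T2_span: "p \<in> M \<Longrightarrow> T2 p = span {E0 p}"
proof
  assume p: "p \<in> M"
  show "T2 p \<subseteq> span {E0 p}"
  proof
    fix u assume "u \<in> T2 p"
    then have "u = \<alpha> p u *\<^sub>R E0 p"
      using lift_coframe[OF p, of u] by (simp add: T2_def lift_def)
    then show "u \<in> span {E0 p}"
      by (metis insertI1 span_base span_scale)
  qed
  have "subspace (T2 p)"
    using subspace_tangent[OF p] by (auto simp: T2_def subspace_def \<omega>_linear)
  then show "span {E0 p} \<subseteq> T2 p"
    using p E_tangent dual by (intro span_minimal) (auto simp: T2_def)
qed

lemma dim_T1: "p \<in> M \<Longrightarrow> dim (T1 p) = 2"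
proof -
  assume p: "p \<in> M"
  have ne: "E1 p \<noteq> k *\<^sub>R E2 p" "E2 p \<noteq> 0" for k
    using dual(5,6)[OF p] by (auto simp: \<omega>_linear complex_eq_iff)
  then have "E1 p \<noteq> E2 p" by (metis scaleR_one)
  moreover from ne have "independent {E1 p, E2 p}"
    by (auto simp: independent_insert span_singleton)
  ultimately show ?thesis
    using dim_span_eq_card_independent[of "{E1 p, E2 p}"] by (simp add: T1_span[OF p] del: dim_span)
qed

lemma dim_T2: "p \<in> M \<Longrightarrow> dim (T2 p) = 1"
proof -
  assume p: "p \<in> M"
  then have "E0 p \<noteq> 0" using dual(1)[OF p] by (auto simp: \<alpha>_linear)
  then show ?thesis by (simp add: T2_span[OF p] dim_span_eq_card_independent)
qed

lemma smooth_distribution_T1: "smooth_distribution M 2 T1"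
  unfolding smooth_distribution_def
proof (intro conjI ballI)
  fix p assume p: "p \<in> M"
  show "T1 p \<subseteq> tangent_space M p" by (auto simp: T1_def)
  show "subspace (T1 p)" by (simp add: T1_span[OF p] subspace_span)
  show "dim (T1 p) = 2" by (rule dim_T1[OF p])
  let ?X = "\<lambda>i::nat. if i = 0 then E1 else E2"
  have "(\<lambda>i. ?X i q) ` {..<2} = {E1 q, E2 q}" for q
    by (auto simp: numeral_2_eq_2 lessThan_Suc)
  then show "\<exists>U (X :: nat \<Rightarrow> 'a \<Rightarrow> 'a). open U \<and> p \<in> U \<and> (\<forall>i<2. smooth_map_on (U \<inter> M) (X i)) \<and>
        (\<forall>q\<in>U \<inter> M. T1 q = span ((\<lambda>i. X i q) ` {..<2}))"
    by (intro exI[of _ UNIV] exI[of _ ?X]) (auto simp: T1_span E_smooth)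
qed

lemma smooth_distribution_T2: "smooth_distribution M 1 T2"
  unfolding smooth_distribution_def
proof (intro conjI ballI)
  fix p assume p: "p \<in> M"
  show "T2 p \<subseteq> tangent_space M p" by (auto simp: T2_def)
  show "subspace (T2 p)" by (simp add: T2_span[OF p] subspace_span)
  show "dim (T2 p) = 1" by (rule dim_T2[OF p])
  show "\<exists>U (X :: nat \<Rightarrow> 'a \<Rightarrow> 'a). open U \<and> p \<in> U \<and> (\<forall>i<1. smooth_map_on (U \<inter> M) (X i)) \<and>
        (\<forall>q\<in>U \<inter> M. T2 q = span ((\<lambda>i. X i q) ` {..<1}))"
    by (intro exI[of _ UNIV] exI[of _ "\<lambda>_. E0"]) (auto simp: T2_span E_smooth lessThan_Suc)
qed

lemma orthogonal_decomposition: "orthogonal_decomposition M metric T1 T2"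
  unfolding orthogonal_decomposition_def
proof (intro ballI conjI)
  fix p assume p: "p \<in> M"
  show "T1 p \<inter> T2 p = {0}"
    using coframe_inj[OF p] subspace_tangent[OF p] by (auto simp: T1_def T2_def \<alpha>_linear \<omega>_linear subspace_0)
  show "metric p u v = 0" if "u \<in> T1 p" "v \<in> T2 p" for u v
    using that by (simp add: T1_def T2_def metric_def)
  show "{u + v |u v. u \<in> T1 p \<and> v \<in> T2 p} = tangent_space M p"
  proof (intro equalityI subsetI)
    fix w assume w: "w \<in> tangent_space M p"
    have "w = lift p 0 (\<omega> p w) + lift p (\<alpha> p w) 0"
      using lift_coframe[OF p w] by (simp add: lift_def algebra_simps)
    moreover have "lift p 0 (\<omega> p w) \<in> T1 p" "lift p (\<alpha> p w) 0 \<in> T2 p"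
      using p by (auto simp: T1_def T2_def lift_tangent coframe_lift)
    ultimately show "w \<in> {u + v |u v. u \<in> T1 p \<and> v \<in> T2 p}" by blast
  qed (use subspace_add[OF subspace_tangent[OF p]] in \<open>auto simp: T1_def T2_def\<close>)
qed

lemma parallel_T1: "parallel_distribution M weyl T1"
  and parallel_T2: "parallel_distribution M weyl T2"
  unfolding parallel_distribution_def
  by (auto simp: T1_def T2_def \<alpha>_weyl \<omega>_weyl vector_fieldsD(2)[OF weyl_field] vector_fieldsD(2)
      intro!: dir_deriv_vanishing)

lemma conformal_product_structure: "conformal_product_structure M metric weyl T1 T2"
  unfolding conformal_product_structure_def
proof (intro conjI)
  show "\<exists>k\<ge>1. smooth_distribution M k T1"
    using smooth_distribution_T1 by (intro exI[of _ 2]) simp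
  show "\<exists>l\<ge>1. smooth_distribution M l T2"
    using smooth_distribution_T2 by (intro exI[of _ 1]) simp
qed (rule weyl_connection orthogonal_decomposition parallel_T1 parallel_T2)+

end

section \<open>A flat function and the profile of the foliation\<close>

lemma tendsto_poly_div_exp:
  fixes p :: "real poly"
  shows "((\<lambda>x. poly p x / exp x) \<longlongrightarrow> 0) at_top"
proof -
  have "((\<lambda>x. \<Sum>i\<le>degree p. coeff p i * (x ^ i / exp x)) \<longlongrightarrow> (\<Sum>i\<le>degree p. coeff p i * 0)) at_top"
    by (intro tendsto_sum tendsto_mult tendsto_const tendsto_power_div_exp_0)
  then show ?thesis by (simp add: poly_altdef sum_divide_distrib)
qed

text \<open>The function \<open>p(1/x) exp(-1/x)\<close>, extended by zero to \<open>x \<le> 0\<close>. This class is closed under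
differentiation, and all its members are flat at the origin.\<close>

definition flat :: "real poly \<Rightarrow> real \<Rightarrow> real" where
  "flat p x = (if x \<le> 0 then 0 else poly p (1 / x) * exp (- (1 / x)))"

lemma flat_has_derivative:
  "(flat p has_real_derivative flat ([:0, 0, 1:] * (p - pderiv p)) x) (at x)"
proof (cases x "0::real" rule: linorder_cases)
  case less
  have "((\<lambda>_. 0) has_real_derivative 0) (at x)" by simp
  then have "(flat p has_real_derivative 0) (at x)"
    by (rule has_field_derivative_transform_within_open[of _ _ _ "{..<0}"])
      (use less in \<open>auto simp: flat_def\<close>)
  then show ?thesis using less by (simp add: flat_def)
next
  case greater
  have "((\<lambda>x. poly p (1 / x) * exp (- (1 / x))) has_real_derivative
      flat ([:0, 0, 1:] * (p - pderiv p)) x) (at x)"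
    using greater
    by (auto intro!: derivative_eq_intros poly_DERIV[THEN DERIV_chain2] simp: flat_def)
      (simp add: field_simps power2_eq_square)
  then show ?thesis
    by (rule has_field_derivative_transform_within_open[of _ _ _ "{0<..}"])
      (use greater in \<open>auto simp: flat_def\<close>)
next
  case equal
  have "((\<lambda>h. poly ([:0, 1:] * p) (inverse h) / exp (inverse h)) \<longlongrightarrow> 0) (at_right 0)"
    using filterlim_compose[OF tendsto_poly_div_exp filterlim_inverse_at_top_right] .
  then have "((\<lambda>h. (flat p h - flat p 0) / (h - 0)) \<longlongrightarrow> 0) (at_right 0)"
    by (rule Lim_transform_eventually)
      (auto simp: eventually_at_filter flat_def exp_minus field_simps)
  moreover have "((\<lambda>h. (flat p h - flat p 0) / (h - 0)) \<longlongrightarrow> 0) (at_left 0)"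
    by (rule Lim_transform_eventually[OF tendsto_const])
      (auto simp: eventually_at_filter flat_def)
  ultimately have "(flat p has_real_derivative 0) (at 0)"
    unfolding has_field_derivative_iff by (simp add: filterlim_split_at)
  then show ?thesis using equal by (simp add: flat_def)
qed

lemma smooth_open_flat: "smooth_open UNIV (flat p)"
proof -
  have "Ck_open k UNIV (flat p)" for k
  proof (induction k arbitrary: p)
    case 0
    show ?case
      using flat_has_derivative by (auto intro!: continuous_at_imp_continuous_on DERIV_isCont)
  next
    case (Suc k)
    show ?case
      by (rule Ck_open_SucI[OF open_UNIV flat_has_derivative[unfolded has_field_derivative_def]])
        (intro Ck_open_bounded_bilinear[OF _ bounded_bilinear_mult] Suc.IH Ck_open_const open_UNIV)
  qed
  then show ?thesis by (simp add: smooth_open_def)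
qed

lemmas smooth_open_mult = smooth_open_bounded_bilinear[OF bounded_bilinear_mult]
lemmas smooth_open_scaleR = smooth_open_bounded_bilinear[OF bounded_bilinear_scaleR]

lemma smooth_open_diff:
  "smooth_open U f \<Longrightarrow> smooth_open U g \<Longrightarrow> smooth_open U (\<lambda>x. f x - g x)"
  using smooth_open_add[OF _ smooth_open_bounded_linear[OF bounded_linear_minus[OF bounded_linear_ident]],
      of U f g] by simp

lemma smooth_open_power2: "smooth_open U f \<Longrightarrow> smooth_open U (\<lambda>x. f x ^ 2 :: real)"
  unfolding power2_eq_square by (rule smooth_open_mult)

lemma smooth_open_divide:
  fixes f g :: "'a::euclidean_space \<Rightarrow> real"
  assumes "smooth_open U f" "smooth_open U g" "\<And>x. x \<in> U \<Longrightarrow> g x \<noteq> 0"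
  shows "smooth_open U (\<lambda>x. f x / g x)"
  unfolding divide_inverse
  by (intro smooth_open_mult assms smooth_open_compose[OF assms(2) smooth_open_inverse])
    (use assms(3) in auto)

text \<open>The function \<open>x\<^sup>2 exp(-1/x)\<close>, extended by zero; \<open>1 / bump (1 - x)\<close> is the derivative of
\<open>exp (1 / (1 - x))\<close> for \<open>x < 1\<close>.\<close>

definition bump :: "real \<Rightarrow> real" where
  "bump x = x\<^sup>2 * flat 1 x"

lemma smooth_open_bump: "smooth_open UNIV bump"
  unfolding bump_def by (intro smooth_open_mult smooth_open_power2 smooth_open_flat smooth_open_id open_UNIV)

lemma bump_nonpos: "x \<le> 0 \<Longrightarrow> bump x = 0"
  and bump_pos: "x > 0 \<Longrightarrow> bump x = x\<^sup>2 * exp (- (1 / x))"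
  by (simp_all add: bump_def flat_def)

text \<open>The coefficient \<open>\<chi>\<close> of the form that defines the Reeb foliation. The factor \<open>1 / (1 - s)\<close> turns
\<open>Im(cnj z\<^sub>1 dz\<^sub>1)\<close> into the differential of the argument of \<open>z\<^sub>1\<close> where \<open>|z\<^sub>2|\<^sup>2 = s\<close>; the value \<open>0\<close> at
\<open>s = 1\<close> is the correct one, since the numerator vanishes for \<open>s \<ge> 1/2\<close>.\<close>

definition cutoff :: "real \<Rightarrow> real" where
  "cutoff s = bump (1 - 2 * s) / (1 - s)"

lemma cutoff_zero: "s \<ge> 1/2 \<Longrightarrow> cutoff s = 0"
  and cutoff_pos: "s < 1/2 \<Longrightarrow> cutoff s > 0"
  by (simp_all add: cutoff_def bump_nonpos bump_pos)

lemma cutoff_nonneg: "cutoff s \<ge> 0"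
  using cutoff_zero[of s] cutoff_pos[of s] by linarith

lemma smooth_open_cutoff: "smooth_open UNIV cutoff"
proof -
  have "smooth_open {..<1} cutoff"
    unfolding cutoff_def
    by (intro smooth_open_divide smooth_open_diff smooth_open_const smooth_open_id
        smooth_open_compose[OF _ smooth_open_bump] smooth_open_mult) auto
  moreover have "smooth_open {1/2<..} cutoff"
    by (rule smooth_open_cong[OF smooth_open_const[of _ 0]]) (simp_all add: cutoff_zero)
  ultimately have "smooth_open ({..<1} \<union> {1/2<..}) cutoff" by (rule smooth_open_Un)
  moreover have "{..<1} \<union> {1/2<..} = (UNIV :: real set)" by auto
  ultimately show ?thesis by simp
qed

lemma smooth_open_has_vector_derivative:
  fixes K :: "real \<Rightarrow> 'b::real_normed_vector"
  assumes "smooth_open U K" "x \<in> U"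
  shows "(K has_vector_derivative frechet_derivative K (at x) 1) (at x)"
  unfolding has_vector_derivative_def
proof (rule has_derivative_eq_rhs[OF smooth_open_has_derivative[OF assms]], rule ext)
  fix v
  show "frechet_derivative K (at x) v = v *\<^sub>R frechet_derivative K (at x) 1"
    using linear_scale[OF has_derivative_linear[OF smooth_open_has_derivative[OF assms]], of v 1]
    by simp
qed

lemma cutoff_deriv: "(cutoff has_real_derivative deriv cutoff s) (at s)"
proof -
  have "(cutoff has_real_derivative frechet_derivative cutoff (at s) 1) (at s)"
    using smooth_open_has_vector_derivative[OF smooth_open_cutoff, of s]
    by (simp add: has_real_derivative_iff_has_vector_derivative)
  then show ?thesis using DERIV_imp_deriv by metis
qed

text \<open>Every \<open>s \<ge> 1/2\<close> is a minimum of the nonnegative function \<open>cutoff\<close>; this includes \<open>s = 1/2\<close>.\<close>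

lemma deriv_cutoff_zero: "s \<ge> 1/2 \<Longrightarrow> deriv cutoff s = 0"
  using DERIV_local_min[OF cutoff_deriv, of 1 s] cutoff_nonneg by (simp add: cutoff_zero)

text \<open>The function that defines the Reeb foliation, in terms of the squared radius.\<close>

definition profile :: "real \<Rightarrow> real" where
  "profile x = exp (1 / (1 - x))"

lemma profile_deriv: "x < 1 \<Longrightarrow> (profile has_real_derivative 1 / bump (1 - x)) (at x)"
  unfolding profile_def
  by (auto intro!: derivative_eq_intros simp: bump_pos exp_minus field_simps power2_eq_square)

lemma smooth_open_profile: "smooth_open {..<1} profile"
  unfolding profile_def
  by (intro smooth_open_compose[OF _ smooth_open_exp] smooth_open_divide smooth_open_diff
      smooth_open_const smooth_open_id) auto

text \<open>The function \<open>f\<close> that defines the Reeb foliation; it is even and smooth on \<open>(-1, 1)\<close>.\<close>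

definition reeb_height :: "real \<Rightarrow> real" where
  "reeb_height r = profile (r\<^sup>2)"

lemma power2_less_1: "\<bar>r\<bar> < 1 \<Longrightarrow> r\<^sup>2 < (1::real)"
  by (simp add: abs_square_less_1)

lemma smooth_open_reeb_height: "smooth_open {-1<..<1} reeb_height"
  unfolding reeb_height_def
  by (intro smooth_open_compose[OF _ smooth_open_profile] smooth_open_power2 smooth_open_id)
    (auto intro!: power2_less_1)

lemma reeb_height_deriv: "\<bar>r\<bar> < 1 \<Longrightarrow> (reeb_height has_real_derivative 2 * r / bump (1 - r\<^sup>2)) (at r)"
  unfolding reeb_height_def
  by (rule DERIV_cong[OF DERIV_chain2[where g = "\<lambda>r. r\<^sup>2", OF profile_deriv[OF power2_less_1]]])
     (auto intro!: derivative_eq_intros)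

lemma reeb_height_at_top: "filterlim reeb_height at_top (at_left 1)"
proof -
  have "((\<lambda>r. 1 - r\<^sup>2) \<longlongrightarrow> 1 - 1\<^sup>2) (at_left (1::real))"
    by (intro tendsto_intros)
  moreover have "\<forall>\<^sub>F r in at_left (1::real). 1 - r\<^sup>2 > 0"
    by (rule eventually_mono[OF eventually_at_left_real[of "-1" 1]]) (auto intro!: power2_less_1)
  ultimately have "filterlim (\<lambda>r. inverse (1 - r\<^sup>2)) at_top (at_left (1::real))"
    by (intro filterlim_inverse_at_top) auto
  then show ?thesis
    unfolding reeb_height_def profile_def using filterlim_compose[OF exp_at_top] by (simp add: divide_inverse)
qed

lemma frechet_derivative_parity:
  fixes F :: "real \<Rightarrow> real"
  assumes F: "smooth_open {-1<..<1} F" and par: "\<And>x. x \<in> {-1<..<1} \<Longrightarrow> F (- x) = c * F x"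
    and x: "x \<in> {-1<..<1}"
  shows "frechet_derivative F (at (- x)) 1 = - c * frechet_derivative F (at x) 1"
proof -
  note D = smooth_open_has_vector_derivative[OF F, folded has_real_derivative_iff_has_vector_derivative]
  have "((\<lambda>x. F (- x)) has_real_derivative frechet_derivative F (at (- x)) 1 * (- 1)) (at x)"
    by (rule DERIV_chain2[of F _ uminus]) (use D x in \<open>auto intro!: derivative_eq_intros\<close>)
  moreover have "((\<lambda>x. F (- x)) has_real_derivative c * frechet_derivative F (at x) 1) (at x)"
    by (rule has_field_derivative_transform_within_open[of "\<lambda>x. c * F x" _ _ "{-1<..<1}"])
      (use D x par in \<open>auto intro!: DERIV_cmult\<close>)
  ultimately have "frechet_derivative F (at (- x)) 1 * (- 1) = c * frechet_derivative F (at x) 1"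
    by (rule DERIV_unique)
  then show ?thesis by simp
qed

text \<open>The iterated one-sided derivatives on \<open>[0, 1)\<close> are restrictions of smooth functions on \<open>(-1, 1)\<close> of
alternating parity, so that those of odd order vanish at the origin.\<close>

lemma iterated_derivative_parity:
  "\<exists>F. smooth_open {-1<..<1} F \<and> (\<forall>x\<in>{-1<..<1}. F (- x) = (-1) ^ n * F x) \<and>
     (\<forall>r\<in>{0..<1}. ((\<lambda>h r. vector_derivative h (at r within {0..<1})) ^^ n) reeb_height r = F r)"
proof (induction n)
  case 0
  have "reeb_height (- x) = reeb_height x" for x by (simp add: reeb_height_def)
  then show ?case using smooth_open_reeb_height by (intro exI[of _ reeb_height]) simp
next
  case (Suc n)
  let ?h = "((\<lambda>h r. vector_derivative h (at r within {0..<1::real})) ^^ n) reeb_height"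
  obtain F where F: "smooth_open {-1<..<1} F" "\<And>x. x \<in> {-1<..<1} \<Longrightarrow> F (- x) = (-1) ^ n * F x"
    and h: "\<And>r. r \<in> {0..<1} \<Longrightarrow> ?h r = F r"
    using Suc by blast
  let ?G = "\<lambda>x. frechet_derivative F (at x) 1"
  have "vector_derivative ?h (at r within {0..<1}) = ?G r" if r: "r \<in> {0..<1}" for r
  proof (rule vector_derivative_within)
    have "r islimpt {0..<1}"
      by (rule islimpt_subset[OF islimpt_greaterThanLessThan1[of r 1]]) (use r in auto)
    then show "at r within {0..<1} \<noteq> bot" by (simp add: trivial_limit_within)
    have FG: "(F has_vector_derivative ?G r) (at r within {0..<1})"
      by (rule has_vector_derivative_at_within[OF smooth_open_has_vector_derivative[OF F(1)]]) (use r in auto)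
    show "(?h has_vector_derivative ?G r) (at r within {0..<1})"
      by (rule has_vector_derivative_transform[OF r h FG])
  qed
  then show ?case
    using smooth_open_frechet_derivative[OF F(1), of 1] frechet_derivative_parity[OF F]
    by (intro exI[of _ ?G]) simp
qed

lemma odd_derivatives_reeb_height:
  "((\<lambda>h r. vector_derivative h (at r within {0..<1})) ^^ (2 * k + 1)) reeb_height 0 = 0"
proof -
  obtain F :: "real \<Rightarrow> real" where
    F: "\<forall>x\<in>{-1<..<1}. F (- x) = (-1) ^ (2 * k + 1) * F x"
    and h: "\<forall>r\<in>{0..<1}. ((\<lambda>h r. vector_derivative h (at r within {0..<1})) ^^ (2 * k + 1)) reeb_height r = F r"
    using iterated_derivative_parity[of "2 * k + 1"] by blast
  have "F 0 = 0" using bspec[OF F, of 0] by simp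
  then show ?thesis using bspec[OF h, of 0] by simp
qed

text \<open>If a function extends smoothly by zero across \<open>1\<close>, then all its derivatives tend to zero there.\<close>

lemma iterated_deriv_flat_at_1:
  assumes "smooth_open {0<..} K" "\<And>x. x > 1 \<Longrightarrow> K x = 0" "\<And>x. x \<in> {0<..<1} \<Longrightarrow> h x = K x"
  shows "((deriv ^^ k) h \<longlongrightarrow> (0::real)) (at_left 1)"
  using assms
proof (induction k arbitrary: h K)
  case 0
  note D = smooth_open_has_vector_derivative[OF 0(1), of 1]
  have cont: "(K \<longlongrightarrow> K 1) (at 1)"
    using has_vector_derivative_continuous[OF D] by (simp add: continuous_within)
  have "(K \<longlongrightarrow> 0) (at_right 1)"
    by (rule Lim_transform_eventually[OF tendsto_const])
      (use 0(2) in \<open>auto simp: eventually_at_filter\<close>)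
  moreover have "(K \<longlongrightarrow> K 1) (at_right 1)" "(K \<longlongrightarrow> K 1) (at_left 1)"
    using cont by (simp_all add: filterlim_split_at_real filterlim_at_split)
  ultimately have "(K \<longlongrightarrow> 0) (at_left 1)"
    using tendsto_unique[OF trivial_limit_at_right_real] by metis
  then have "(h \<longlongrightarrow> 0) (at_left 1)"
    by (rule Lim_transform_eventually)
      (use eventually_at_left_real[of 0 1] 0(3) in \<open>auto elim!: eventually_mono\<close>)
  then show ?case by simp
next
  case (Suc k)
  note D = smooth_open_has_vector_derivative[OF Suc.prems(1),
      folded has_real_derivative_iff_has_vector_derivative]
  let ?K = "\<lambda>x. frechet_derivative K (at x) 1"
  have "((deriv ^^ k) (deriv h) \<longlongrightarrow> 0) (at_left 1)"
  proof (rule Suc.IH[of ?K])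
    show "smooth_open {0<..} ?K" by (rule smooth_open_frechet_derivative[OF Suc.prems(1)])
    show "?K x = 0" if "x > 1" for x
    proof -
      have "(K has_real_derivative 0) (at x)"
        by (rule has_field_derivative_transform_within_open[of "\<lambda>_. 0" _ _ "{1<..}"])
          (use that Suc.prems(2) in auto)
      then show ?thesis using D[of x] that DERIV_unique by auto
    qed
    show "deriv h x = ?K x" if "x \<in> {0<..<1}" for x
    proof (rule DERIV_imp_deriv)
      show "(h has_real_derivative ?K x) (at x)"
        by (rule has_field_derivative_transform_within_open[of K _ _ "{0<..<1}"])
          (use that Suc.prems(3) D in auto)
    qed
  qed
  then show ?case by (simp add: funpow_Suc_right del: funpow.simps)
qed

lemma reeb_function_reeb_height: "reeb_function reeb_height"
  unfolding reeb_function_def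
proof (intro conjI allI impI)
  show "smooth_map_on {0..<1} reeb_height"
    by (rule smooth_open_imp_smooth_map_on[OF smooth_open_reeb_height]) auto
  have d: "deriv reeb_height r = 2 * r / bump (1 - r\<^sup>2)" if "\<bar>r\<bar> < 1" for r
    by (rule DERIV_imp_deriv[OF reeb_height_deriv[OF that]])
  show "deriv reeb_height r > 0" if "0 < r \<and> r < 1" for r
    using that power2_less_1[of r] by (simp add: d bump_pos)
  show "filterlim reeb_height at_top (at_left 1)" by (rule reeb_height_at_top)
  show "((\<lambda>h r. vector_derivative h (at r within {0..<1})) ^^ (2 * k + 1)) reeb_height 0 = 0" for k
    by (rule odd_derivatives_reeb_height)
  show "((deriv ^^ k) (\<lambda>r. 1 / deriv reeb_height r) \<longlongrightarrow> 0) (at_left 1)" for k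
  proof (rule iterated_deriv_flat_at_1[where K = "\<lambda>r. bump (1 - r\<^sup>2) / (2 * r)"])
    show "smooth_open {0<..} (\<lambda>r. bump (1 - r\<^sup>2) / (2 * r))"
      by (intro smooth_open_divide smooth_open_compose[OF _ smooth_open_bump] smooth_open_diff
          smooth_open_power2 smooth_open_const smooth_open_id smooth_open_mult) auto
    show "bump (1 - r\<^sup>2) / (2 * r) = 0" if "r > 1" for r
      using that by (simp add: bump_nonpos one_le_power)
    show "1 / deriv reeb_height r = bump (1 - r\<^sup>2) / (2 * r)" if "r \<in> {0<..<1}" for r
      using that by (simp add: d)
  qed
qed

section \<open>The three-sphere and its tangent spaces\<close>

lemma S3_iff: "p \<in> S3 \<longleftrightarrow> p \<bullet> p = 1"
  by (cases p) (auto simp: S3_def power2_norm_eq_inner)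

lemma tangent_space_S3:
  assumes p: "p \<in> S3"
  shows "tangent_space S3 p = {v. p \<bullet> v = 0}"
proof (intro equalityI subsetI CollectI)
  fix v assume v: "v \<in> tangent_space S3 p"
  have "((\<lambda>q. q \<bullet> q) has_derivative (\<lambda>u. p \<bullet> u + u \<bullet> p)) (at p within S3)"
    by (intro has_derivative_inner has_derivative_ident)
  from dir_deriv_eq[OF p v this] have "dir_deriv S3 (\<lambda>q. q \<bullet> q) p v = 2 * (p \<bullet> v)"
    by (simp add: inner_commute)
  moreover have "((\<lambda>q. q \<bullet> q) has_derivative (\<lambda>u. 0)) (at p within S3)"
    by (rule has_derivative_transform[OF p _ has_derivative_const[of 1]]) (simp add: S3_iff)
  from dir_deriv_eq[OF p v this] have "dir_deriv S3 (\<lambda>q. q \<bullet> q) p v = 0" .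
  ultimately show "p \<bullet> v = 0" by simp
next
  fix v assume "v \<in> {v. p \<bullet> v = 0}"
  then have v: "p \<bullet> v = 0" by simp
  define h where "h = (\<lambda>t::real. 1 + t * t * (v \<bullet> v))"
  \<comment> \<open>the line through \<open>p\<close> in direction \<open>v\<close>, projected radially to the sphere\<close>
  define \<gamma> where "\<gamma> = (\<lambda>t. inverse (sqrt (h t)) *\<^sub>R (p + t *\<^sub>R v))"
  have h: "h t > 0" for t by (auto simp: h_def intro: add_pos_nonneg)
  have "smooth_open UNIV h"
    unfolding h_def by (intro smooth_open_add smooth_open_mult smooth_open_const smooth_open_id open_UNIV)
  then have "smooth_open UNIV (\<lambda>t. sqrt (h t))"
    using h by (intro smooth_open_compose[OF _ smooth_open_sqrt]) auto
  then have "smooth_open UNIV (\<lambda>t. inverse (sqrt (h t)))"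
    using h by (intro smooth_open_compose[OF _ smooth_open_inverse]) (auto simp: less_imp_neq[symmetric])
  then have "smooth_open UNIV \<gamma>"
    unfolding \<gamma>_def
    by (intro smooth_open_scaleR smooth_open_add smooth_open_const smooth_open_id open_UNIV)
  then have smooth: "smooth_map_on {-1<..<1} \<gamma>"
    by (rule smooth_open_imp_smooth_map_on) auto
  have "(p + t *\<^sub>R v) \<bullet> (p + t *\<^sub>R v) = h t" for t
    using p v by (simp add: S3_iff h_def inner_add_left inner_add_right inner_commute algebra_simps)
  then have "\<gamma> t \<bullet> \<gamma> t = inverse (sqrt (h t)) * inverse (sqrt (h t)) * h t" for t
    by (simp add: \<gamma>_def)
  then have "\<gamma> t \<bullet> \<gamma> t = 1" for t
    using h[of t] by (simp add: divide_inverse[symmetric] field_simps)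
  then have sphere: "\<gamma> ` {-1<..<1} \<subseteq> S3" by (auto simp: S3_iff)
  have "(h has_real_derivative 0) (at 0)"
    unfolding h_def by (auto intro!: derivative_eq_intros)
  then have "((\<lambda>t. sqrt (h t)) has_real_derivative inverse (sqrt (h 0)) / 2 * 0) (at 0)"
    using h[of 0] by (intro DERIV_chain2[OF DERIV_real_sqrt])
  then have "((\<lambda>t. inverse (sqrt (h t))) has_real_derivative 0) (at 0)"
    using h[of 0] by (intro DERIV_cong[OF DERIV_inverse_fun]) auto
  moreover have "((\<lambda>t. p + t *\<^sub>R v) has_vector_derivative v) (at 0)"
    by (auto intro!: derivative_eq_intros simp: has_vector_derivative_def)
  ultimately have "(\<gamma> has_vector_derivative inverse (sqrt (h 0)) *\<^sub>R v + 0 *\<^sub>R (p + 0 *\<^sub>R v)) (at 0)"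
    unfolding \<gamma>_def by (intro has_vector_derivative_scaleR)
  then have "(\<gamma> has_vector_derivative v) (at 0)" by (simp add: h_def)
  moreover have "\<gamma> 0 = p" by (simp add: \<gamma>_def h_def)
  ultimately show "v \<in> tangent_space S3 p"
    unfolding tangent_space_def using smooth sphere by (intro CollectI exI[of _ \<gamma>] exI[of _ 1]) auto
qed

lemma subspace_tangent_S3: "p \<in> S3 \<Longrightarrow> subspace (tangent_space S3 p)"
  by (simp add: tangent_space_S3 subspace_def inner_right_distrib)

text \<open>The field \<open>p\<close> is normal to the sphere and \<open>v \<mapsto> p \<bullet> v\<close> is a closed form, so that Cartan's formula
shows the bracket of tangent fields to be tangent.\<close>

lemma bracket_tangent_S3:
  assumes X: "X \<in> vector_fields S3" and Y: "Y \<in> vector_fields S3" and p: "p \<in> S3"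
  shows "lie_bracket S3 X Y p \<in> tangent_space S3 p"
proof -
  have form: "smooth_form S3 (\<lambda>q v. q \<bullet> v)"
    unfolding smooth_form_def
    by (intro conjI allI linearI smooth_map_on_inner smooth_map_on_id smooth_map_on_const)
      (simp_all only: inner_right_distrib inner_scaleR_right real_scaleR_def)
  have d: "dir_deriv S3 (\<lambda>q. q \<bullet> v) p u = u \<bullet> v" if "u \<in> tangent_space S3 p" for u v
    by (rule dir_deriv_eq[OF p that has_derivative_inner_left[OF has_derivative_ident]])
  have z: "dir_deriv S3 (\<lambda>q. q \<bullet> V q) p u = 0"
    if "V \<in> vector_fields S3" "u \<in> tangent_space S3 p" for u V
    by (rule dir_deriv_vanishing[OF _ p that(2)])
      (use vector_fieldsD(2)[OF that(1)] in \<open>simp add: tangent_space_S3\<close>)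
  show ?thesis
    using form_lie_bracket[OF form X Y p] vector_fieldsD(2)[OF X p] vector_fieldsD(2)[OF Y p]
    by (simp add: tangent_space_S3[OF p] z[OF X] z[OF Y] ext_deriv_def d inner_commute)
qed

section \<open>The coframe on the three-sphere\<close>

text \<open>The form \<open>Im(cnj z dz)\<close> on the plane, which is \<open>|z|\<^sup>2\<close> times the differential of the argument.\<close>

definition ang :: "complex \<Rightarrow> complex \<Rightarrow> real" where
  "ang z x = Im (cnj z * x)"

lemma ang_inner_identity: "(z \<bullet> z) * ang u v = (z \<bullet> u) * ang z v - (z \<bullet> v) * ang z u"
  by (simp add: ang_def inner_complex_def algebra_simps)

lemma bounded_bilinear_ang: "bounded_bilinear ang"
proof -
  have "ang = (\<lambda>z x. z \<bullet> (- \<i> * x))"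
    by (simp add: fun_eq_iff ang_def inner_complex_def)
  then show ?thesis
    using bounded_bilinear.comp[OF bounded_bilinear_inner bounded_linear_ident
        bounded_linear_mult_right[of "- \<i>"]] by simp
qed

text \<open>The form \<open>\<chi>(|z\<^sub>2|\<^sup>2) Im(cnj z\<^sub>1 dz\<^sub>1) - \<chi>(|z\<^sub>1|\<^sup>2) Im(cnj z\<^sub>2 dz\<^sub>2) - 2 d|z\<^sub>2|\<^sup>2\<close>, whose kernel is tangent
to the Reeb foliation.\<close>

definition reeb_form :: "complex \<times> complex \<Rightarrow> complex \<times> complex \<Rightarrow> real" where
  "reeb_form p v = cutoff (snd p \<bullet> snd p) * ang (fst p) (fst v)
     - cutoff (fst p \<bullet> fst p) * ang (snd p) (snd v) - 4 * (snd p \<bullet> snd v)"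

text \<open>The form \<open>z\<^sub>1 d(cnj z\<^sub>2) - \<i> cnj z\<^sub>2 dz\<^sub>1\<close>, which defines a transversely holomorphic flow on the sphere.\<close>

definition trans_form :: "complex \<times> complex \<Rightarrow> complex \<times> complex \<Rightarrow> complex" where
  "trans_form p v = fst p * cnj (snd v) - \<i> * cnj (snd p) * fst v"

lemmas smooth_map_on_fst = smooth_map_on_bounded_linear[OF bounded_linear_fst smooth_map_on_id]
lemmas smooth_map_on_snd = smooth_map_on_bounded_linear[OF bounded_linear_snd smooth_map_on_id]
lemmas smooth_map_on_cnj = smooth_map_on_bounded_linear[OF bounded_linear_cnj]
lemmas smooth_map_on_ang = smooth_map_on_bounded_bilinear[OF bounded_bilinear_ang]
lemma smooth_map_on_cutoff: "smooth_map_on A f \<Longrightarrow> smooth_map_on A (\<lambda>x. cutoff (f x))"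
  by (rule smooth_map_on_compose[OF _ smooth_open_cutoff]) auto

lemma ang_linear: "ang z (u + v) = ang z u + ang z v" "ang z (c *\<^sub>R u) = c * ang z u"
  by (simp_all add: ang_def algebra_simps)

lemma smooth_form_reeb: "smooth_form M reeb_form"
  unfolding smooth_form_def
proof (intro conjI allI)
  show "linear (reeb_form p)" for p
    by (rule linearI) (simp_all add: reeb_form_def ang_linear inner_right_distrib algebra_simps)
  show "smooth_map_on M (\<lambda>p. reeb_form p v)" for v
    unfolding reeb_form_def
    by (intro smooth_map_on_diff smooth_map_on_mult smooth_map_on_cutoff smooth_map_on_ang
        smooth_map_on_inner smooth_map_on_fst smooth_map_on_snd smooth_map_on_const)
qed

lemma smooth_form_trans: "smooth_form M trans_form"
  unfolding smooth_form_def
proof (intro conjI allI)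
  show "linear (trans_form p)" for p
    by (rule linearI) (simp_all add: trans_form_def algebra_simps)
  show "smooth_map_on M (\<lambda>p. trans_form p v)" for v
    unfolding trans_form_def
    by (intro smooth_map_on_diff smooth_map_on_mult smooth_map_on_cnj
        smooth_map_on_fst smooth_map_on_snd smooth_map_on_const)
qed

lemma ext_deriv_trans:
  assumes p: "p \<in> M" and u: "u \<in> tangent_space M p" and v: "v \<in> tangent_space M p"
  shows "ext_deriv M trans_form p u v = (1 + \<i>) * (fst u * cnj (snd v) - fst v * cnj (snd u))"
proof -
  have "dir_deriv M (\<lambda>q. trans_form q b) p a = fst a * cnj (snd b) - \<i> * cnj (snd a) * fst b"
    if "a \<in> tangent_space M p" for a b
  proof (rule dir_deriv_eq[OF p that])
    show "((\<lambda>q. trans_form q b) has_derivative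
        (\<lambda>a. fst a * cnj (snd b) - \<i> * cnj (snd a) * fst b)) (at p within M)"
      unfolding trans_form_def
      by (auto intro!: derivative_eq_intros has_derivative_cnj)
  qed
  then show ?thesis
    using u v by (simp add: ext_deriv_def algebra_simps)
qed

lemma cutoff_normsq_has_derivative:
  assumes "(h has_derivative h') (at p within M)"
  shows "((\<lambda>q. cutoff (h q \<bullet> h q)) has_derivative
    (\<lambda>a. deriv cutoff (h p \<bullet> h p) * (2 * (h p \<bullet> h' a)))) (at p within M)"
proof -
  have "((\<lambda>q. h q \<bullet> h q) has_derivative (\<lambda>a. 2 * (h p \<bullet> h' a))) (at p within M)"
    by (rule has_derivative_eq_rhs[OF has_derivative_inner[OF assms assms]])
      (simp add: inner_commute)
  from has_derivative_compose[OF this cutoff_deriv[unfolded has_field_derivative_def]]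
  show ?thesis .
qed

lemma ext_deriv_reeb:
  assumes p: "p \<in> M" and u: "u \<in> tangent_space M p" and v: "v \<in> tangent_space M p"
  shows "ext_deriv M reeb_form p u v =
    2 * deriv cutoff (snd p \<bullet> snd p) *
        ((snd p \<bullet> snd u) * ang (fst p) (fst v) - (snd p \<bullet> snd v) * ang (fst p) (fst u))
    + 2 * cutoff (snd p \<bullet> snd p) * ang (fst u) (fst v)
    - 2 * deriv cutoff (fst p \<bullet> fst p) *
        ((fst p \<bullet> fst u) * ang (snd p) (snd v) - (fst p \<bullet> fst v) * ang (snd p) (snd u))
    - 2 * cutoff (fst p \<bullet> fst p) * ang (snd u) (snd v)"
proof -
  have fst: "(fst has_derivative fst) (at p within M)" and snd: "(snd has_derivative snd) (at p within M)"
    by (auto intro: bounded_linear_imp_has_derivative bounded_linear_fst bounded_linear_snd)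
  have ang: "((\<lambda>q. ang (h q) c) has_derivative (\<lambda>a. ang (h' a) c)) (at p within M)"
    if "(h has_derivative h') (at p within M)" for h h' c
    by (rule bounded_linear.has_derivative[OF bounded_bilinear.bounded_linear_left[OF bounded_bilinear_ang] that])
  have D: "dir_deriv M (\<lambda>q. reeb_form q b) p a =
     (cutoff (snd p \<bullet> snd p) * ang (fst a) (fst b)
        + deriv cutoff (snd p \<bullet> snd p) * (2 * (snd p \<bullet> snd a)) * ang (fst p) (fst b))
     - (cutoff (fst p \<bullet> fst p) * ang (snd a) (snd b)
        + deriv cutoff (fst p \<bullet> fst p) * (2 * (fst p \<bullet> fst a)) * ang (snd p) (snd b))
     - 4 * (snd a \<bullet> snd b)"
    if "a \<in> tangent_space M p" for a b
    unfolding reeb_form_def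
    by (rule dir_deriv_eq[OF p that])
      (intro has_derivative_diff has_derivative_mult cutoff_normsq_has_derivative fst snd ang
        has_derivative_mult_right has_derivative_inner_left)
  have "ang (fst v) (fst u) = - ang (fst u) (fst v)" "ang (snd v) (snd u) = - ang (snd u) (snd v)"
    by (simp_all add: ang_def)
  then show ?thesis
    unfolding ext_deriv_def D[OF u] D[OF v] by (simp add: inner_commute[of "snd u"] algebra_simps)
qed

text \<open>The Frobenius condition for the Reeb form. On each half of the sphere only one of the two cutoff terms
survives; on the kernel, \<open>d|z\<^sub>i|\<^sup>2\<close> is then a multiple of the angular form, and the two-form vanishes.\<close>

lemma reeb_form_integrable:
  assumes p: "p \<in> S3" and u: "u \<in> tangent_space S3 p" and v: "v \<in> tangent_space S3 p"
    and "reeb_form p u = 0" "reeb_form p v = 0"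
  shows "ext_deriv S3 reeb_form p u v = 0"
proof -
  obtain z\<^sub>1 z\<^sub>2 u\<^sub>1 u\<^sub>2 v\<^sub>1 v\<^sub>2 where eq: "p = (z\<^sub>1, z\<^sub>2)" "u = (u\<^sub>1, u\<^sub>2)" "v = (v\<^sub>1, v\<^sub>2)"
    by (metis prod.exhaust)
  have sum: "z\<^sub>1 \<bullet> z\<^sub>1 + z\<^sub>2 \<bullet> z\<^sub>2 = 1" using p by (simp add: S3_iff eq)
  have tan: "z\<^sub>1 \<bullet> u\<^sub>1 = - (z\<^sub>2 \<bullet> u\<^sub>2)" "z\<^sub>1 \<bullet> v\<^sub>1 = - (z\<^sub>2 \<bullet> v\<^sub>2)"
    using u v unfolding tangent_space_S3[OF p] by (simp_all add: eq)
  note E = ext_deriv_reeb[OF p u v, unfolded eq fst_conv snd_conv]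
  consider "z\<^sub>1 \<bullet> z\<^sub>1 \<ge> 1/2" | "z\<^sub>2 \<bullet> z\<^sub>2 \<ge> 1/2" using sum by linarith
  then show ?thesis
  proof cases
    case 1
    then have ker: "z\<^sub>2 \<bullet> u\<^sub>2 = cutoff (z\<^sub>2 \<bullet> z\<^sub>2) / 4 * ang z\<^sub>1 u\<^sub>1" "z\<^sub>2 \<bullet> v\<^sub>2 = cutoff (z\<^sub>2 \<bullet> z\<^sub>2) / 4 * ang z\<^sub>1 v\<^sub>1"
      using assms(4,5) by (simp_all add: reeb_form_def eq cutoff_zero)
    have "(z\<^sub>1 \<bullet> z\<^sub>1) * ang u\<^sub>1 v\<^sub>1 = 0"
      unfolding ang_inner_identity tan ker by simp
    then have "ang u\<^sub>1 v\<^sub>1 = 0" using 1 by auto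
    then show ?thesis
      unfolding eq E by (simp add: ker cutoff_zero[OF 1] deriv_cutoff_zero[OF 1])
  next
    case 2
    then have ker: "z\<^sub>2 \<bullet> u\<^sub>2 = - (cutoff (z\<^sub>1 \<bullet> z\<^sub>1) / 4 * ang z\<^sub>2 u\<^sub>2)" "z\<^sub>2 \<bullet> v\<^sub>2 = - (cutoff (z\<^sub>1 \<bullet> z\<^sub>1) / 4 * ang z\<^sub>2 v\<^sub>2)"
      using assms(4,5) by (simp_all add: reeb_form_def eq cutoff_zero)
    have "(z\<^sub>2 \<bullet> z\<^sub>2) * ang u\<^sub>2 v\<^sub>2 = 0"
      unfolding ang_inner_identity ker by simp
    then have "ang u\<^sub>2 v\<^sub>2 = 0" using 2 by auto
    then show ?thesis
      unfolding eq E by (simp add: tan ker cutoff_zero[OF 2] deriv_cutoff_zero[OF 2])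
  qed
qed

section \<open>The dual frame on the three-sphere\<close>

text \<open>The vector field that spans the kernel of \<open>trans_form\<close> in the tangent bundle of the sphere, namely
\<open>((|z\<^sub>2|\<^sup>2 + \<i> |z\<^sub>1|\<^sup>2) z\<^sub>1, - (|z\<^sub>1|\<^sup>2 + \<i> |z\<^sub>2|\<^sup>2) z\<^sub>2)\<close>.\<close>

definition flow_dir :: "complex \<times> complex \<Rightarrow> complex \<times> complex" where
  "flow_dir p = (Complex (snd p \<bullet> snd p) (fst p \<bullet> fst p) * fst p,
     - (Complex (fst p \<bullet> fst p) (snd p \<bullet> snd p) * snd p))"

text \<open>The contact plane of the sphere at \<open>p\<close> (the complex tangent line in the coordinates \<open>(z\<^sub>1, cnj z\<^sub>2)\<close>),
parametrised by \<open>d \<in> \<complex>\<close>.\<close>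

definition contact :: "complex \<Rightarrow> complex \<times> complex \<Rightarrow> complex \<times> complex" where
  "contact d p = (- d * snd p, cnj d * fst p)"

text \<open>On the contact plane, \<open>trans_form\<close> is multiplication by \<open>|z\<^sub>1|\<^sup>2 + \<i> |z\<^sub>2|\<^sup>2\<close>. The coefficient is \<open>c\<close>
divided by this number.\<close>

definition horiz_coeff :: "complex \<Rightarrow> complex \<times> complex \<Rightarrow> complex" where
  "horiz_coeff c p = c * Complex (fst p \<bullet> fst p) (- (snd p \<bullet> snd p)) *
     complex_of_real (inverse ((fst p \<bullet> fst p)\<^sup>2 + (snd p \<bullet> snd p)\<^sup>2))"

text \<open>The vector of the contact plane on which \<open>trans_form\<close> takes the value \<open>c\<close>.\<close>

definition horiz :: "complex \<Rightarrow> complex \<times> complex \<Rightarrow> complex \<times> complex" where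
  "horiz c p = contact (horiz_coeff c p) p"

lemma inner_self_complex: "complex_of_real (z \<bullet> z) = z * cnj z"
  by (simp add: complex_eq_iff inner_complex_def)

lemma flow_dir_tangent: "p \<bullet> flow_dir p = 0"
  by (simp add: flow_dir_def inner_prod_def inner_complex_def algebra_simps)

lemma horiz_tangent: "p \<bullet> horiz c p = 0"
  by (simp add: horiz_def contact_def inner_prod_def inner_complex_def algebra_simps)

lemma trans_flow_dir: "trans_form p (flow_dir p) = 0"
  by (simp add: trans_form_def flow_dir_def complex_eq_iff algebra_simps)

lemma normsq_sum_pos: "p \<in> S3 \<Longrightarrow> (fst p \<bullet> fst p)\<^sup>2 + (snd p \<bullet> snd p)\<^sup>2 > 0"
  by (metis S3_iff add_0 inner_prod_def sum_power2_gt_zero_iff zero_neq_one)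

lemma trans_horiz:
  assumes "p \<in> S3"
  shows "trans_form p (horiz c p) = c"
proof -
  let ?m = "(fst p \<bullet> fst p)\<^sup>2 + (snd p \<bullet> snd p)\<^sup>2"
  have "trans_form p (contact d p) = d * Complex (fst p \<bullet> fst p) (snd p \<bullet> snd p)" for d
    by (simp add: trans_form_def contact_def complex_eq_iff inner_complex_def algebra_simps)
  then have "trans_form p (horiz c p) = c * (Complex (fst p \<bullet> fst p) (- (snd p \<bullet> snd p)) *
      Complex (fst p \<bullet> fst p) (snd p \<bullet> snd p)) * complex_of_real (inverse ?m)"
    unfolding horiz_def horiz_coeff_def by (simp only: mult_ac)
  also have "Complex (fst p \<bullet> fst p) (- (snd p \<bullet> snd p)) * Complex (fst p \<bullet> fst p) (snd p \<bullet> snd p)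
      = complex_of_real ?m"
    by (simp add: complex_eq_iff power2_eq_square)
  also have "c * complex_of_real ?m * complex_of_real (inverse ?m) = c * complex_of_real (?m * inverse ?m)"
    by (simp only: of_real_mult mult.assoc)
  also have "?m * inverse ?m = 1"
    by (rule right_inverse) (use normsq_sum_pos[OF assms] in linarith)
  finally show ?thesis by (simp only: of_real_1 mult_1_right)
qed

text \<open>The flow is transverse to the Reeb foliation. On the core circles, where the last term vanishes, one of
the cutoff terms is positive.\<close>

lemma reeb_flow_dir_pos:
  assumes "p \<in> S3"
  shows "reeb_form p (flow_dir p) > 0"
proof -
  let ?a = "fst p \<bullet> fst p" and ?b = "snd p \<bullet> snd p"
  have ab: "?a + ?b = 1" "?a \<ge> 0" "?b \<ge> 0" using assms by (simp_all add: S3_iff inner_prod_def)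
  have eq: "reeb_form p (flow_dir p) = cutoff ?b * ?a\<^sup>2 + cutoff ?a * ?b\<^sup>2 + 4 * (?a * ?b)"
    by (simp add: reeb_form_def flow_dir_def ang_def inner_complex_def power2_eq_square algebra_simps)
  consider "?a = 0" "?b = 1" | "?b = 0" "?a = 1" | "?a > 0" "?b > 0" using ab by linarith
  then show ?thesis
    by cases (auto simp: eq cutoff_nonneg intro!: cutoff_pos add_nonneg_pos add_nonneg_nonneg mult_nonneg_nonneg)
qed

lemma trans_form_kernel:
  assumes p: "p \<in> S3" and u: "p \<bullet> u = 0" and \<omega>: "trans_form p u = 0"
  obtains t where "u = t *\<^sub>R flow_dir p"
proof -
  obtain z\<^sub>1 z\<^sub>2 u\<^sub>1 u\<^sub>2 where eq: "p = (z\<^sub>1, z\<^sub>2)" "u = (u\<^sub>1, u\<^sub>2)" by (metis prod.exhaust)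
  let ?a = "z\<^sub>1 \<bullet> z\<^sub>1" and ?b = "z\<^sub>2 \<bullet> z\<^sub>2"
  let ?m = "?a\<^sup>2 + ?b\<^sup>2"
  have pos: "?m > 0" using normsq_sum_pos[OF p] by (simp add: eq)
  \<comment> \<open>in the coordinates \<open>(z\<^sub>1, cnj z\<^sub>2)\<close>, \<open>u\<close> is the multiple \<open>m\<close> of the unit vector \<open>(z\<^sub>1, \<i> cnj z\<^sub>2)\<close>, and tangency makes \<open>m\<close> a real multiple of \<open>\<i> (|z\<^sub>1|\<^sup>2 - \<i> |z\<^sub>2|\<^sup>2)\<close>\<close>
  define m where "m = cnj z\<^sub>1 * u\<^sub>1 - \<i> * z\<^sub>2 * cnj u\<^sub>2"
  define t where "t = Im (m * Complex ?a ?b) / ?m"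
  have one: "z\<^sub>1 * cnj z\<^sub>1 + z\<^sub>2 * cnj z\<^sub>2 = 1"
    using p by (simp add: S3_iff eq flip: inner_self_complex of_real_add)
  have k: "z\<^sub>1 * cnj u\<^sub>2 = \<i> * cnj z\<^sub>2 * u\<^sub>1" using \<omega> by (simp add: trans_form_def eq)
  have ii: "\<i> * \<i> = -1" by simp
  have "m * z\<^sub>1 = (z\<^sub>1 * cnj z\<^sub>1 + z\<^sub>2 * cnj z\<^sub>2) * u\<^sub>1"
    using k ii unfolding m_def by algebra
  then have mu1: "u\<^sub>1 = m * z\<^sub>1" by (simp add: one)
  have "\<i> * m * cnj z\<^sub>2 = (z\<^sub>1 * cnj z\<^sub>1 + z\<^sub>2 * cnj z\<^sub>2) * cnj u\<^sub>2"
    using k ii unfolding m_def by algebra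
  then have "cnj u\<^sub>2 = \<i> * m * cnj z\<^sub>2" by (simp add: one)
  then have mu2: "u\<^sub>2 = - (\<i> * cnj m * z\<^sub>2)" by (metis complex_cnj_cnj complex_cnj_i complex_cnj_mult mult_minus_left)
  have "Re (m * Complex ?a ?b) = 0"
    using u unfolding eq mu1 mu2 by (simp add: inner_complex_def algebra_simps)
  then have "m * Complex ?a ?b = \<i> * complex_of_real (t * ?m)"
    using iffD1[OF nonzero_eq_divide_eq[OF less_imp_neq[OF pos, symmetric]] t_def]
    by (simp add: complex_eq_iff)
  then have "m * (Complex ?a ?b * Complex ?a (- ?b)) = \<i> * complex_of_real (t * ?m) * Complex ?a (- ?b)"
    by (metis mult.assoc)
  moreover have "Complex ?a ?b * Complex ?a (- ?b) = complex_of_real ?m"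
    by (simp add: complex_eq_iff power2_eq_square)
  ultimately have "m * complex_of_real ?m = (t *\<^sub>R (\<i> * Complex ?a (- ?b))) * complex_of_real ?m"
    by (simp add: scaleR_conv_of_real algebra_simps)
  moreover have "complex_of_real ?m \<noteq> 0"
    using pos by (simp only: of_real_eq_0_iff)
  ultimately have m: "m = t *\<^sub>R (\<i> * Complex ?a (- ?b))" by (metis mult_right_cancel)
  have "u = t *\<^sub>R flow_dir p"
    unfolding eq mu1 mu2 m flow_dir_def by (simp add: complex_eq_iff algebra_simps)
  then show ?thesis by (rule that)
qed

text \<open>The frame dual to the coframe, extended by zero off the sphere: \<open>frame0\<close> is the normalised flow, and
\<open>frameC c\<close> is the lift of \<open>c\<close> to the kernel of \<open>reeb_form\<close>, obtained from the contact plane by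
projecting along the flow.\<close>

definition frame0 :: "complex \<times> complex \<Rightarrow> complex \<times> complex" where
  "frame0 p = (if p \<in> S3 then inverse (reeb_form p (flow_dir p)) *\<^sub>R flow_dir p else 0)"

definition frameC :: "complex \<Rightarrow> complex \<times> complex \<Rightarrow> complex \<times> complex" where
  "frameC c p = (if p \<in> S3 then horiz c p - reeb_form p (horiz c p) *\<^sub>R frame0 p else 0)"

lemma smooth_map_on_inner_self:
  "smooth_map_on A (\<lambda>p :: complex \<times> complex. fst p \<bullet> fst p)"
  "smooth_map_on A (\<lambda>p :: complex \<times> complex. snd p \<bullet> snd p)"
  by (intro smooth_map_on_inner smooth_map_on_fst smooth_map_on_snd)+

lemma smooth_flow_dir: "smooth_map_on A flow_dir"
  unfolding flow_dir_def
  by (intro smooth_map_on_Pair smooth_map_on_mult smooth_map_on_minus smooth_map_on_Complex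
      smooth_map_on_inner_self smooth_map_on_fst smooth_map_on_snd)

lemma smooth_horiz: "smooth_map_on S3 (horiz c)"
  unfolding horiz_def contact_def horiz_coeff_def power2_eq_square
  using normsq_sum_pos[unfolded power2_eq_square]
  by (intro smooth_map_on_Pair smooth_map_on_mult smooth_map_on_minus smooth_map_on_Complex
      smooth_map_on_inner_self smooth_map_on_fst smooth_map_on_snd smooth_map_on_cnj
      smooth_map_on_const smooth_map_on_bounded_linear[OF bounded_linear_of_real]
      smooth_map_on_inverse smooth_map_on_add) fastforce+

lemma frame0_field: "frame0 \<in> vector_fields S3"
proof -
  have "smooth_map_on S3 (\<lambda>p. inverse (reeb_form p (flow_dir p)) *\<^sub>R flow_dir p)"
    using reeb_flow_dir_pos
    by (intro smooth_map_on_scaleR smooth_map_on_inverse smooth_flow_dir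
        smooth_form_apply[OF smooth_form_reeb smooth_flow_dir]) fastforce
  then have "smooth_map_on S3 frame0"
    by (rule smooth_map_on_cong) (simp add: frame0_def)
  then show ?thesis
    by (auto simp: vector_fields_def frame0_def tangent_space_S3 flow_dir_tangent)
qed

lemma frameC_field: "frameC c \<in> vector_fields S3"
proof -
  have "smooth_map_on S3 (\<lambda>p. horiz c p - reeb_form p (horiz c p) *\<^sub>R frame0 p)"
    by (intro smooth_map_on_diff smooth_map_on_scaleR smooth_horiz
        smooth_form_apply[OF smooth_form_reeb smooth_horiz] vector_fieldsD(1)[OF frame0_field])
  then have "smooth_map_on S3 (frameC c)"
    by (rule smooth_map_on_cong) (simp add: frameC_def)
  then show ?thesis
    by (auto simp: vector_fields_def frameC_def frame0_def tangent_space_S3 flow_dir_tangent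
        horiz_tangent inner_diff_right)
qed

lemma dual_frame:
  assumes "p \<in> S3"
  shows "reeb_form p (frame0 p) = 1" "reeb_form p (frameC c p) = 0"
    "trans_form p (frame0 p) = 0" "trans_form p (frameC c p) = c"
  using assms reeb_flow_dir_pos[OF assms]
  by (simp_all add: frame0_def frameC_def smooth_form_linear[OF smooth_form_reeb]
      smooth_form_linear[OF smooth_form_trans] trans_flow_dir trans_horiz)

text \<open>The Lie derivative of \<open>trans_form\<close> along the flow is a complex multiple of \<open>trans_form\<close>: the flow is
transversely holomorphic.\<close>

lemma ext_deriv_trans_flow_dir:
  assumes p: "p \<in> S3" and v: "v \<in> tangent_space S3 p"
  shows "ext_deriv S3 trans_form p (frame0 p) v =
    (1 + \<i>) * Complex (snd p \<bullet> snd p) (fst p \<bullet> fst p) *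
      complex_of_real (inverse (reeb_form p (flow_dir p))) * trans_form p v"
proof -
  have f: "fst (flow_dir p) * cnj (snd v) - fst v * cnj (snd (flow_dir p))
      = Complex (snd p \<bullet> snd p) (fst p \<bullet> fst p) * trans_form p v"
    by (simp add: flow_dir_def trans_form_def complex_eq_iff algebra_simps)
  have "ext_deriv S3 trans_form p (frame0 p) v = (1 + \<i>) *
     (complex_of_real (inverse (reeb_form p (flow_dir p))) *
       (fst (flow_dir p) * cnj (snd v) - fst v * cnj (snd (flow_dir p))))"
    unfolding ext_deriv_trans[OF p vector_fieldsD(2)[OF frame0_field p] v]
    using p by (simp add: frame0_def scaleR_conv_of_real algebra_simps)
  then show ?thesis unfolding f by (simp add: mult_ac)
qed

section \<open>Tangent spaces of the leaves\<close>

lemma tangent_space_graph: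
  fixes G :: "'a::euclidean_space \<Rightarrow> 'b::euclidean_space"
  assumes G: "smooth_open U G" and z: "z \<in> U" and D: "(G has_derivative D) (at z)"
  shows "tangent_space ((\<lambda>z. (G z, z)) ` U) (G z, z) = range (\<lambda>x. (D x, x))"
proof (intro equalityI subsetI)
  let ?M = "(\<lambda>z. (G z, z)) ` U"
  have p: "(G z, z) \<in> ?M" using z by blast
  fix v assume v: "v \<in> tangent_space ?M (G z, z)"
  have "((\<lambda>q. fst q - G (snd q)) has_derivative (\<lambda>u. fst u - D (snd u))) (at (G z, z) within ?M)"
    using D by (intro has_derivative_diff has_derivative_compose[where f = snd and g = G]
        bounded_linear_imp_has_derivative bounded_linear_fst bounded_linear_snd) auto
  from dir_deriv_eq[OF p v this] have "dir_deriv ?M (\<lambda>q. fst q - G (snd q)) (G z, z) v = fst v - D (snd v)"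
    by simp
  moreover have "dir_deriv ?M (\<lambda>q. fst q - G (snd q)) (G z, z) v = 0"
    by (rule dir_deriv_vanishing[OF _ p v]) auto
  ultimately have "fst v = D (snd v)" by simp
  then show "v \<in> range (\<lambda>x. (D x, x))" by (intro range_eqI[of _ _ "snd v"]) (simp add: prod_eq_iff)
next
  let ?M = "(\<lambda>z. (G z, z)) ` U"
  fix v assume "v \<in> range (\<lambda>x. (D x, x))"
  then obtain x where v: "v = (D x, x)" by blast
  let ?l = "\<lambda>t::real. z + t *\<^sub>R x"
  let ?\<gamma> = "\<lambda>t. (G (?l t), ?l t)"
  have l: "smooth_open UNIV ?l"
    by (intro smooth_open_add smooth_open_scaleR smooth_open_const smooth_open_id open_UNIV)
  have "open (?l -` U)"
    using smooth_open_openD[OF G] by (intro open_vimage continuous_intros)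
  then obtain e where e: "e > 0" "ball 0 e \<subseteq> ?l -` U"
    using z openE[of "?l -` U" 0] by auto
  then have sub: "?l t \<in> U" if "t \<in> {-e<..<e}" for t using that by (auto simp: subset_eq dist_real_def)
  have sl: "smooth_map_on {-e<..<e} ?l"
    by (rule smooth_open_imp_smooth_map_on[OF l]) simp
  have "smooth_map_on {-e<..<e} ?\<gamma>"
    by (intro smooth_map_on_Pair smooth_map_on_compose[OF sl G] sl) (use sub in auto)
  moreover have "?\<gamma> ` {-e<..<e} \<subseteq> ?M" using sub by auto
  moreover have "(?\<gamma> has_vector_derivative v) (at 0)"
  proof -
    have dl: "(?l has_derivative (\<lambda>t. t *\<^sub>R x)) (at 0)"
      by (auto intro!: derivative_eq_intros)
    have "((\<lambda>t. G (?l t)) has_derivative (\<lambda>t. D (t *\<^sub>R x))) (at 0)"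
      using has_derivative_compose[OF dl, of G D] D by simp
    then show ?thesis
      unfolding has_vector_derivative_def v
      using has_derivative_Pair[OF _ dl] linear_scale[OF has_derivative_linear[OF D]] by fastforce
  qed
  ultimately show "v \<in> tangent_space ?M (G z, z)"
    unfolding tangent_space_def using e(1) by (intro CollectI exI[of _ ?\<gamma>] exI[of _ e]) simp
qed

lemma tangent_space_linear_image_subset:
  fixes h :: "'a::euclidean_space \<Rightarrow> 'b::euclidean_space"
  assumes "bounded_linear h"
  shows "h ` tangent_space M p \<subseteq> tangent_space (h ` M) (h p)"
proof
  fix w assume "w \<in> h ` tangent_space M p"
  then obtain \<gamma> e v where "w = h v" "e > 0" "smooth_map_on {-e<..<e} \<gamma>" "\<gamma> ` {-e<..<e} \<subseteq> M" "\<gamma> 0 = p"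
      "(\<gamma> has_vector_derivative v) (at (0::real))"
    unfolding tangent_space_def by blast
  then show "w \<in> tangent_space (h ` M) (h p)"
    unfolding tangent_space_def
    using smooth_map_on_bounded_linear[OF assms] bounded_linear.has_vector_derivative[OF assms]
    by (intro CollectI exI[of _ "\<lambda>t. h (\<gamma> t)"] exI[of _ e]) auto
qed

lemma bounded_linear_swap:
  "bounded_linear (prod.swap :: 'a::real_normed_vector \<times> 'b::real_normed_vector \<Rightarrow> 'b \<times> 'a)"
proof -
  have eq: "prod.swap = (\<lambda>p :: 'a \<times> 'b. (snd p, fst p))" by (simp add: fun_eq_iff)
  show ?thesis
    unfolding eq by (rule bounded_linear_Pair[OF bounded_linear_snd bounded_linear_fst])
qed

lemma tangent_space_swap:
  fixes M :: "('a::euclidean_space \<times> 'b::euclidean_space) set"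
  shows "tangent_space (prod.swap ` M) (prod.swap p) = prod.swap ` tangent_space M p"
proof
  show "prod.swap ` tangent_space M p \<subseteq> tangent_space (prod.swap ` M) (prod.swap p)"
    by (rule tangent_space_linear_image_subset[OF bounded_linear_swap])
  have "prod.swap ` tangent_space (prod.swap ` M) (prod.swap p) \<subseteq> tangent_space M p"
    using tangent_space_linear_image_subset[OF bounded_linear_swap, of "prod.swap ` M" "prod.swap p"]
    by (simp add: image_comp)
  then have "prod.swap ` prod.swap ` tangent_space (prod.swap ` M) (prod.swap p) \<subseteq> prod.swap ` tangent_space M p"
    by (rule image_mono)
  then show "tangent_space (prod.swap ` M) (prod.swap p) \<subseteq> prod.swap ` tangent_space M p"
    by (simp add: image_comp)
qed

text \<open>The plane field defined by \<open>reeb_form\<close>.\<close>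

definition reeb_distribution :: "complex \<times> complex \<Rightarrow> (complex \<times> complex) set" where
  "reeb_distribution p = {u \<in> tangent_space S3 p. reeb_form p u = 0}"

lemma reeb_distribution_iff:
  "(z\<^sub>1, z\<^sub>2) \<in> S3 \<Longrightarrow> (u\<^sub>1, u\<^sub>2) \<in> reeb_distribution (z\<^sub>1, z\<^sub>2) \<longleftrightarrow>
     z\<^sub>1 \<bullet> u\<^sub>1 + z\<^sub>2 \<bullet> u\<^sub>2 = 0 \<and>
     cutoff (z\<^sub>2 \<bullet> z\<^sub>2) * ang z\<^sub>1 u\<^sub>1 - cutoff (z\<^sub>1 \<bullet> z\<^sub>1) * ang z\<^sub>2 u\<^sub>2 - 4 * (z\<^sub>2 \<bullet> u\<^sub>2) = 0"
  by (simp add: reeb_distribution_def tangent_space_S3 reeb_form_def)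

text \<open>Exchanging the two solid tori changes the sign of \<open>reeb_form\<close> on tangent vectors of the sphere.\<close>

lemma reeb_distribution_swap:
  assumes "p \<in> S3"
  shows "reeb_distribution (prod.swap p) = prod.swap ` reeb_distribution p"
proof -
  obtain z\<^sub>1 z\<^sub>2 where p: "p = (z\<^sub>1, z\<^sub>2)" by (cases p)
  have S: "(z\<^sub>1, z\<^sub>2) \<in> S3" "(z\<^sub>2, z\<^sub>1) \<in> S3" using assms by (simp_all add: p S3_iff add.commute)
  have "(u\<^sub>2, u\<^sub>1) \<in> reeb_distribution (z\<^sub>2, z\<^sub>1) \<longleftrightarrow> (u\<^sub>1, u\<^sub>2) \<in> reeb_distribution (z\<^sub>1, z\<^sub>2)" for u\<^sub>1 u\<^sub>2
    unfolding reeb_distribution_iff[OF S(1)] reeb_distribution_iff[OF S(2)] by linarith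
  then have "w \<in> reeb_distribution (prod.swap p) \<longleftrightarrow> prod.swap w \<in> reeb_distribution p" for w
    by (cases w) (simp add: p)
  moreover have "w \<in> prod.swap ` A \<longleftrightarrow> prod.swap w \<in> A" for w :: "complex \<times> complex" and A
    by (metis image_iff swap_swap)
  ultimately show ?thesis by blast
qed

text \<open>Each leaf in the first solid torus is a graph over the disc \<open>|z\<^sub>2|\<^sup>2 < 1/2\<close>, given by this function,
since \<open>z\<^sub>2 = w / \<surd>2\<close> gives \<open>|w|\<^sup>2 = 2 |z\<^sub>2|\<^sup>2\<close>.\<close>

definition leaf_graph :: "real \<Rightarrow> complex \<Rightarrow> complex" where
  "leaf_graph c z = cis (c + profile (2 * (z \<bullet> z))) * complex_of_real (sqrt (1 - z \<bullet> z))"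

text \<open>The open disc of squared radius \<open>1/2\<close>.\<close>

definition half_disc :: "complex set" where
  "half_disc = {z. z \<bullet> z < 1 / 2}"

lemma \<Phi>\<^sub>1_leaf: "\<Phi>\<^sub>1 ` open_torus_leaf reeb_height c = (\<lambda>z. (leaf_graph c z, z)) ` half_disc"
proof -
  have key: "\<Phi>\<^sub>1 (w, cis (c + reeb_height (cmod w))) = (leaf_graph c z, z)" "z \<bullet> z = (cmod w)\<^sup>2 / 2"
    if z: "z = w / complex_of_real (sqrt 2)" for w z
  proof -
    have "(cmod z)\<^sup>2 = (cmod w)\<^sup>2 / 2" by (simp add: z norm_divide power_divide)
    then show zz: "z \<bullet> z = (cmod w)\<^sup>2 / 2" by (simp add: power2_norm_eq_inner)
    show "\<Phi>\<^sub>1 (w, cis (c + reeb_height (cmod w))) = (leaf_graph c z, z)"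
      unfolding leaf_graph_def zz by (simp add: \<Phi>\<^sub>1_def reeb_height_def z)
  qed
  show ?thesis
  proof (intro equalityI subsetI)
    fix q assume "q \<in> \<Phi>\<^sub>1 ` open_torus_leaf reeb_height c"
    then obtain w where w: "cmod w < 1" "q = \<Phi>\<^sub>1 (w, cis (c + reeb_height (cmod w)))"
      unfolding open_torus_leaf_def by (auto simp: algebra_simps)
    then have "(cmod w)\<^sup>2 < 1" by (simp add: power_less_one_iff)
    then show "q \<in> (\<lambda>z. (leaf_graph c z, z)) ` half_disc"
      unfolding w(2) using key[of "w / complex_of_real (sqrt 2)" w] by (auto simp: half_disc_def)
  next
    fix q assume "q \<in> (\<lambda>z. (leaf_graph c z, z)) ` half_disc"
    then obtain z where z: "z \<bullet> z < 1 / 2" "q = (leaf_graph c z, z)" by (auto simp: half_disc_def)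
    define w where "w = complex_of_real (sqrt 2) * z"
    have zw: "z = w / complex_of_real (sqrt 2)" by (simp add: w_def)
    have "(cmod w)\<^sup>2 < 1\<^sup>2" using key(2)[OF zw] z(1) by simp
    then have "cmod w < 1" by (rule power_less_imp_less_base) simp
    then show "q \<in> \<Phi>\<^sub>1 ` open_torus_leaf reeb_height c"
      unfolding z(2) key(1)[OF zw, symmetric] open_torus_leaf_def
      by (intro imageI) (auto simp: image_iff intro!: exI[of _ w] exI[of _ "c + reeb_height (cmod w)"])
  qed
qed

lemma \<Phi>\<^sub>2_leaf: "\<Phi>\<^sub>2 ` open_torus_leaf reeb_height c = prod.swap ` (\<lambda>z. (leaf_graph c z, z)) ` half_disc"
proof -
  have "\<Phi>\<^sub>2 = prod.swap \<circ> \<Phi>\<^sub>1" by (auto simp: \<Phi>\<^sub>1_def \<Phi>\<^sub>2_def fun_eq_iff)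
  then show ?thesis unfolding \<Phi>\<^sub>1_leaf[symmetric] by (simp add: image_comp)
qed

lemma smooth_leaf_graph: "smooth_open half_disc (leaf_graph c)"
proof -
  have "open half_disc" unfolding half_disc_def by (intro open_Collect_less continuous_intros)
  then have sq: "smooth_open half_disc (\<lambda>z. z \<bullet> z)"
    by (intro smooth_open_bounded_bilinear[OF bounded_bilinear_inner] smooth_open_id)
  show ?thesis
    unfolding leaf_graph_def
    by (intro smooth_open_mult smooth_open_bounded_linear[OF bounded_linear_of_real]
        smooth_open_compose[OF _ smooth_open_cis] smooth_open_compose[OF _ smooth_open_sqrt]
        smooth_open_compose[OF _ smooth_open_profile] smooth_open_add smooth_open_diff sq
        smooth_open_const smooth_open_openD[OF sq])
      (auto simp: half_disc_def)
qed

lemma leaf_graph_has_derivative: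
  assumes z: "z \<bullet> z < 1 / 2"
  shows "(leaf_graph c has_derivative
    (\<lambda>x. Complex (- (z \<bullet> x) / (1 - z \<bullet> z)) (4 * (z \<bullet> x) / bump (1 - 2 * (z \<bullet> z))) * leaf_graph c z)) (at z)"
proof -
  let ?s = "z \<bullet> z" let ?r = "sqrt (1 - z \<bullet> z)"
  have r: "?r > 0" "?r * ?r = 1 - ?s" using z by simp_all
  have scale: "inverse R / 2 * (0 - 2 * a) = - a / S * R" if "R > 0" "R * R = S" for R S a :: real
    using that(1) unfolding that(2)[symmetric] by (simp add: field_simps)
  have sq: "((\<lambda>z. z \<bullet> z) has_derivative (\<lambda>x. 2 * (z \<bullet> x))) (at z)"
    by (rule has_derivative_eq_rhs[OF has_derivative_inner[OF has_derivative_ident has_derivative_ident]])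
      (simp add: inner_commute)
  have 1: "((\<lambda>z. c + profile (2 * (z \<bullet> z))) has_derivative
      (\<lambda>x. 1 / bump (1 - 2 * ?s) * (2 * (2 * (z \<bullet> x))))) (at z)"
    using has_derivative_compose[OF has_derivative_mult_right[OF sq, of 2]
        profile_deriv[of "2 * ?s", unfolded has_field_derivative_def]] z
    by (auto intro!: derivative_eq_intros)
  have 2: "((\<lambda>z. sqrt (1 - z \<bullet> z)) has_derivative (\<lambda>x. inverse ?r / 2 * (0 - 2 * (z \<bullet> x)))) (at z)"
    using has_derivative_compose[OF has_derivative_diff[OF has_derivative_const[of 1] sq]
        DERIV_real_sqrt[of "1 - ?s", unfolded has_field_derivative_def]] z by simp
  show ?thesis
    unfolding leaf_graph_def
  proof (rule has_derivative_eq_rhs[OF has_derivative_mult[OF has_derivative_cis[OF 1]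
          has_derivative_of_real[OF 2]]], rule ext)
    fix x
    let ?C = "cis (c + profile (2 * ?s))" and ?k = "4 * (z \<bullet> x) / bump (1 - 2 * ?s)"
    have "inverse ?r / 2 * (0 - 2 * (z \<bullet> x)) = - (z \<bullet> x) / (1 - ?s) * ?r"
      by (rule scale[OF r])
    moreover have "1 / bump (1 - 2 * ?s) * (2 * (2 * (z \<bullet> x))) = ?k" by simp
    ultimately show "?C * complex_of_real (inverse ?r / 2 * (0 - 2 * (z \<bullet> x))) +
        ((1 / bump (1 - 2 * ?s) * (2 * (2 * (z \<bullet> x)))) *\<^sub>R (\<i> * ?C)) * complex_of_real ?r =
        Complex (- (z \<bullet> x) / (1 - ?s)) ?k * (?C * complex_of_real ?r)"
      by (simp only: of_real_mult scaleR_conv_of_real Complex_eq) (simp add: algebra_simps)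
  qed
qed

lemma leaf_graph_normsq: "z \<bullet> z < 1 / 2 \<Longrightarrow> leaf_graph c z \<bullet> leaf_graph c z = 1 - z \<bullet> z"
  by (simp add: leaf_graph_def norm_mult flip: power2_norm_eq_inner add: power_mult_distrib)

lemma leaf_graph_S3: "z \<in> half_disc \<Longrightarrow> (leaf_graph c z, z) \<in> S3"
  by (simp add: S3_iff leaf_graph_normsq half_disc_def)

lemma reeb_distribution_leaf:
  assumes z: "z \<in> half_disc"
  shows "reeb_distribution (leaf_graph c z, z) =
    tangent_space ((\<lambda>z. (leaf_graph c z, z)) ` half_disc) (leaf_graph c z, z)"
proof -
  let ?g = "leaf_graph c z" and ?s = "z \<bullet> z"
  let ?k = "\<lambda>x. Complex (- (z \<bullet> x) / (1 - ?s)) (4 * (z \<bullet> x) / bump (1 - 2 * ?s))"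
  have s: "?s < 1 / 2" using z by (simp add: half_disc_def)
  note gg = leaf_graph_normsq[OF s, of c]
  have gg': "cnj ?g * ?g = complex_of_real (1 - ?s)"
    using inner_self_complex[of ?g] gg by (simp add: mult.commute)
  then have g0: "?g \<noteq> 0" using s by (auto simp: complex_eq_iff)
  have "(u, x) \<in> reeb_distribution (?g, z) \<longleftrightarrow> u = ?k x * ?g" for u x
  proof -
    have "u = ?k x * ?g \<longleftrightarrow> cnj ?g * u = ?k x * complex_of_real (1 - ?s)"
      unfolding gg'[symmetric] using g0 by (simp add: mult.left_commute)
    also have "\<dots> \<longleftrightarrow> ?g \<bullet> u = - (z \<bullet> x) \<and> ang ?g u = 4 * (z \<bullet> x) / bump (1 - 2 * ?s) * (1 - ?s)"
      using s by (simp add: complex_eq_iff inner_complex_def ang_def)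
    also have "4 * (z \<bullet> x) / bump (1 - 2 * ?s) * (1 - ?s) = 4 * (z \<bullet> x) / cutoff ?s"
      by (simp add: cutoff_def)
    also have "?g \<bullet> u = - (z \<bullet> x) \<and> ang ?g u = 4 * (z \<bullet> x) / cutoff ?s \<longleftrightarrow>
        (u, x) \<in> reeb_distribution (?g, z)"
      unfolding reeb_distribution_iff[OF leaf_graph_S3[OF z]] gg
      using cutoff_pos[OF s] s by (auto simp: cutoff_zero field_simps)
    finally show ?thesis by blast
  qed
  then show ?thesis
    unfolding tangent_space_graph[OF smooth_leaf_graph z leaf_graph_has_derivative[OF s]]
    by auto
qed

lemma torus_iff: "(z\<^sub>1, z\<^sub>2) \<in> torus \<longleftrightarrow> z\<^sub>1 \<bullet> z\<^sub>1 = 1 / 2 \<and> z\<^sub>2 \<bullet> z\<^sub>2 = 1 / 2"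
  by (simp add: torus_def power2_norm_eq_inner)

lemma tangent_space_torus:
  assumes p: "(z\<^sub>1, z\<^sub>2) \<in> torus"
  shows "tangent_space torus (z\<^sub>1, z\<^sub>2) = {(u\<^sub>1, u\<^sub>2). z\<^sub>1 \<bullet> u\<^sub>1 = 0 \<and> z\<^sub>2 \<bullet> u\<^sub>2 = 0}"
proof (intro equalityI subsetI)
  fix v assume v: "v \<in> tangent_space torus (z\<^sub>1, z\<^sub>2)"
  have "h (z\<^sub>1, z\<^sub>2) \<bullet> h v = 0"
    if h: "bounded_linear h" "\<And>q. q \<in> torus \<Longrightarrow> h q \<bullet> h q = 1 / 2" for h :: "complex \<times> complex \<Rightarrow> complex"
  proof -
    have "((\<lambda>q. h q \<bullet> h q - 1 / 2) has_derivative (\<lambda>u. (h (z\<^sub>1, z\<^sub>2) \<bullet> h u + h u \<bullet> h (z\<^sub>1, z\<^sub>2)) - 0)) (at (z\<^sub>1, z\<^sub>2) within torus)"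
      by (intro has_derivative_diff has_derivative_const has_derivative_inner bounded_linear_imp_has_derivative h(1))
    from dir_deriv_eq[OF p v this] dir_deriv_vanishing[OF _ p v, of "\<lambda>q. h q \<bullet> h q - 1 / 2"] h(2)
    show ?thesis by (simp add: inner_commute)
  qed
  from this[OF bounded_linear_fst] this[OF bounded_linear_snd]
  show "v \<in> {(u\<^sub>1, u\<^sub>2). z\<^sub>1 \<bullet> u\<^sub>1 = 0 \<and> z\<^sub>2 \<bullet> u\<^sub>2 = 0}"
    by (cases v) (auto simp: torus_iff)
next
  fix v assume "v \<in> {(u\<^sub>1, u\<^sub>2). z\<^sub>1 \<bullet> u\<^sub>1 = 0 \<and> z\<^sub>2 \<bullet> u\<^sub>2 = 0}"
  then obtain u\<^sub>1 u\<^sub>2 where v: "v = (u\<^sub>1, u\<^sub>2)" "z\<^sub>1 \<bullet> u\<^sub>1 = 0" "z\<^sub>2 \<bullet> u\<^sub>2 = 0" by blast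
  have rot: "u = (2 * ang z u) *\<^sub>R (\<i> * z)" if "z \<bullet> z = 1 / 2" "z \<bullet> u = 0" for z u
  proof -
    have "cnj z * u = \<i> * complex_of_real (ang z u)"
      using that(2) by (simp add: complex_eq_iff inner_complex_def ang_def)
    then have "(z * cnj z) * u = z * (\<i> * complex_of_real (ang z u))" by (simp add: mult.assoc)
    moreover have "z * cnj z = 1 / 2" using inner_self_complex[of z] that(1) by simp
    ultimately show ?thesis by (simp add: scaleR_conv_of_real field_simps)
  qed
  define a where "a = 2 * ang z\<^sub>1 u\<^sub>1"
  define b where "b = 2 * ang z\<^sub>2 u\<^sub>2"
  have u: "u\<^sub>1 = a *\<^sub>R (\<i> * z\<^sub>1)" "u\<^sub>2 = b *\<^sub>R (\<i> * z\<^sub>2)"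
    using rot p v(2,3) unfolding a_def b_def by (simp_all add: torus_iff)
  let ?\<gamma> = "\<lambda>t. (cis (t * a) * z\<^sub>1, cis (t * b) * z\<^sub>2)"
  have c: "smooth_map_on {-1<..<1} (\<lambda>t. cis (t * k))" for k
    by (intro smooth_map_on_compose[OF _ smooth_open_cis] smooth_map_on_mult smooth_map_on_id smooth_map_on_const) auto
  have "smooth_map_on {-1<..<1} ?\<gamma>"
    by (intro smooth_map_on_Pair smooth_map_on_mult c smooth_map_on_const)
  moreover have "?\<gamma> ` {-1<..<1} \<subseteq> torus"
    using p by (auto simp: torus_def norm_mult)
  moreover have "(?\<gamma> has_vector_derivative v) (at 0)"
  proof -
    have "((\<lambda>t. cis (t * k) * z) has_derivative (\<lambda>t. t *\<^sub>R (k *\<^sub>R (\<i> * z)))) (at 0)" for k z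
      by (rule has_derivative_eq_rhs[OF has_derivative_mult_left[OF has_derivative_cis[OF
            has_derivative_mult_left[OF has_derivative_ident]]]]) (simp add: fun_eq_iff)
    then show ?thesis
      unfolding has_vector_derivative_def v(1) u by (auto intro!: has_derivative_Pair)
  qed
  ultimately show "v \<in> tangent_space torus (z\<^sub>1, z\<^sub>2)"
    unfolding tangent_space_def by (intro CollectI exI[of _ ?\<gamma>] exI[of _ 1]) simp
qed

lemma reeb_distribution_torus:
  assumes p: "p \<in> torus"
  shows "reeb_distribution p = tangent_space torus p"
proof -
  obtain z\<^sub>1 z\<^sub>2 where eq: "p = (z\<^sub>1, z\<^sub>2)" by (cases p)
  have z: "z\<^sub>1 \<bullet> z\<^sub>1 = 1 / 2" "z\<^sub>2 \<bullet> z\<^sub>2 = 1 / 2" using p by (simp_all add: eq torus_iff)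
  have S: "(z\<^sub>1, z\<^sub>2) \<in> S3" by (simp add: S3_iff z)
  have "(u\<^sub>1, u\<^sub>2) \<in> reeb_distribution p \<longleftrightarrow> z\<^sub>1 \<bullet> u\<^sub>1 = 0 \<and> z\<^sub>2 \<bullet> u\<^sub>2 = 0" for u\<^sub>1 u\<^sub>2
    unfolding eq reeb_distribution_iff[OF S] z by (auto simp: cutoff_zero)
  then show ?thesis unfolding eq tangent_space_torus[OF p[unfolded eq]] by auto
qed

lemma tangent_distribution_reeb: "tangent_distribution_of (reeb_foliation reeb_height) reeb_distribution"
  unfolding tangent_distribution_of_def
proof (intro ballI)
  fix L p assume "L \<in> reeb_foliation reeb_height" and p: "p \<in> L"
  then consider c where "L = \<Phi>\<^sub>1 ` open_torus_leaf reeb_height c" | c where "L = \<Phi>\<^sub>2 ` open_torus_leaf reeb_height c"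
    | "L = torus"
    unfolding reeb_foliation_def open_torus_foliation_def by blast
  then show "reeb_distribution p = tangent_space L p"
  proof cases
    case 1
    then show ?thesis using p unfolding \<Phi>\<^sub>1_leaf by (auto simp: reeb_distribution_leaf)
  next
    case 2
    then obtain z where z: "z \<in> half_disc" "p = prod.swap (leaf_graph c z, z)"
      using p unfolding \<Phi>\<^sub>2_leaf by auto
    show ?thesis
      unfolding 2 \<Phi>\<^sub>2_leaf z(2) tangent_space_swap reeb_distribution_swap[OF leaf_graph_S3[OF z(1)]]
      by (simp only: reeb_distribution_leaf[OF z(1)])
  next
    case 3
    then show ?thesis using p reeb_distribution_torus by simp
  qed
qed

section \<open>The conformal product structure on the three-sphere\<close>

lemma integrable_coframe_S3:
  "integrable_coframe S3 reeb_form trans_form frame0 (frameC 1) (frameC \<i>)"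
proof
  fix p assume p: "p \<in> S3"
  note tan = vector_fieldsD(2)[OF frameC_field p]
  show "reeb_form p (frame0 p) = 1" "reeb_form p (frameC 1 p) = 0" "reeb_form p (frameC \<i> p) = 0"
    "trans_form p (frame0 p) = 0" "trans_form p (frameC 1 p) = 1" "trans_form p (frameC \<i> p) = \<i>"
    by (simp_all add: dual_frame p)
  show "subspace (tangent_space S3 p)" by (rule subspace_tangent_S3[OF p])
  show "u = 0" if u: "u \<in> tangent_space S3 p" "reeb_form p u = 0" "trans_form p u = 0" for u
  proof -
    have "p \<bullet> u = 0" using u(1) by (simp add: tangent_space_S3[OF p])
    then obtain t where "u = t *\<^sub>R flow_dir p" using trans_form_kernel[OF p _ u(3)] by blast
    then show ?thesis
      using u(2) reeb_flow_dir_pos[OF p] by (simp add: smooth_form_linear[OF smooth_form_reeb])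
  qed
  show "ext_deriv S3 reeb_form p (frameC 1 p) (frameC \<i> p) = 0"
    by (rule reeb_form_integrable[OF p tan tan dual_frame(2)[OF p] dual_frame(2)[OF p]])
  show "ext_deriv S3 trans_form p (frame0 p) (frameC \<i> p) =
      \<i> * ext_deriv S3 trans_form p (frame0 p) (frameC 1 p)"
    by (simp add: ext_deriv_trans_flow_dir[OF p tan] dual_frame(4)[OF p])
qed (rule bracket_tangent_S3 smooth_form_reeb smooth_form_trans frame0_field frameC_field; assumption?)+

theorem mainTheorem1:
  shows "\<exists>(f :: real \<Rightarrow> real)
           (g :: complex \<times> complex \<Rightarrow> complex \<times> complex \<Rightarrow> complex \<times> complex \<Rightarrow> real)
           (D :: (complex \<times> complex \<Rightarrow> complex \<times> complex) \<Rightarrow>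
                 (complex \<times> complex \<Rightarrow> complex \<times> complex) \<Rightarrow>
                 complex \<times> complex \<Rightarrow> complex \<times> complex)
           (T\<^sub>1 :: complex \<times> complex \<Rightarrow> (complex \<times> complex) set)
           (T\<^sub>2 :: complex \<times> complex \<Rightarrow> (complex \<times> complex) set).
           reeb_function f \<and>
           riemannian_metric S3 g \<and>
           conformal_product_structure S3 g D T\<^sub>1 T\<^sub>2 \<and>
           smooth_distribution S3 2 T\<^sub>1 \<and>
           smooth_distribution S3 1 T\<^sub>2 \<and>
           tangent_distribution_of (reeb_foliation f) T\<^sub>1"
proof -
  interpret integrable_coframe S3 reeb_form trans_form frame0 "frameC 1" "frameC \<i>"
    by (rule integrable_coframe_S3)
  have "T1 = reeb_distribution"
    by (simp add: fun_eq_iff T1_def reeb_distribution_def)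
  then have "tangent_distribution_of (reeb_foliation reeb_height) T1"
    using tangent_distribution_reeb by simp
  then show ?thesis
    using reeb_function_reeb_height riemannian_metric conformal_product_structure
      smooth_distribution_T1 smooth_distribution_T2 by blast
qed

end
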